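(* Let $(\Omega,\mu)$ be a finite probability space, $r\ge1$, $\gamma_2>\gamma_1>0$, and let $d$ be a nonnegative integer with $d\le\frac12\log(\gamma_2/\gamma_1)$. Let $f\colon\Omega^n\to\mathbb{R}$ be both $(r,\gamma_1,d)$-$L_1$-global and $(r,\gamma_2,d)$-$L_2$-global. Set \[r'_d=\frac{\sqrt d}{\log^{1/2}(\gamma_2/\gamma_1)},\qquad \gamma'_d=\left(\frac{33r}{\sqrt d}\right)^d\gamma_1\log^{d/2}\!\left(\frac{\gamma_2}{\gamma_1}\right).\] Then $f^{=d}$ is $(r'_d,\gamma'_d)$-$L_2$-global.
   Context: Norms w.r.t. $\mu^n$; $\log$ natural; convention $(\cdot)^0=1$. For $i\in[n]$, $E_i$ averages over coordinate $i$ according to $\mu$, $L_i=I-E_i$, $E_S=\prod_{i\in S}E_i$, $L_S=\prod_{i\in S}L_i$; $f^{=T}=E_{[n]\setminus T}L_Tf$, $f^{=d}=\sum_{|T|=d}f^{=T}$. Derivative: $D_{S,x}g=(L_Sg)_{S\to x}$ with $h_{S\to x}(y)=h(x,y)$. For $p\ge1$, $g$ is $(r,\gamma,d)$-$L_p$-global if $\|D_{S,x}g\|_p\le r^{|S|}\gamma$ for all $S\subseteq[n]$ with $|S|\le d$ and all $x\in\Omega^S$; $g$ is $(r,\gamma)$-$L_2$-global if $\|D_{S,x}g\|_2\le r^{|S|}\gamma$ for all $S\subseteq[n]$ and $x\in\Omega^S$. *)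

theory Defs
  imports Complex_Main "HOL-Library.FuncSet"
begin

text \<open>Finite probability space: the finite type 'a with weights mu (mu a \<ge> 0, sum = 1).
Points of Omega^I are extensional functions in PiE I (\<lambda>_. UNIV); a function on Omega^n
is a map (nat \<Rightarrow> 'a) \<Rightarrow> real evaluated at points of PiE {..<n} (\<lambda>_. UNIV).\<close>

definition prob_weights :: "('a::finite \<Rightarrow> real) \<Rightarrow> bool" where
  "prob_weights \<mu> \<longleftrightarrow> (\<forall>a. \<mu> a \<ge> 0) \<and> sum \<mu> UNIV = 1"

definition E_coord :: "('a::finite \<Rightarrow> real) \<Rightarrow> nat \<Rightarrow> ((nat \<Rightarrow> 'a) \<Rightarrow> real) \<Rightarrow> ((nat \<Rightarrow> 'a) \<Rightarrow> real)" where
  "E_coord \<mu> i g = (\<lambda>x. \<Sum>a\<in>UNIV. \<mu> a * g (x(i := a)))"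

definition L_coord :: "('a::finite \<Rightarrow> real) \<Rightarrow> nat \<Rightarrow> ((nat \<Rightarrow> 'a) \<Rightarrow> real) \<Rightarrow> ((nat \<Rightarrow> 'a) \<Rightarrow> real)" where
  "L_coord \<mu> i g = (\<lambda>x. g x - E_coord \<mu> i g x)"

text \<open>E_S = prod_{i in S} E_i, L_S = prod_{i in S} L_i (the factors commute).\<close>
definition E_set :: "('a::finite \<Rightarrow> real) \<Rightarrow> nat set \<Rightarrow> ((nat \<Rightarrow> 'a) \<Rightarrow> real) \<Rightarrow> ((nat \<Rightarrow> 'a) \<Rightarrow> real)" where
  "E_set \<mu> S g = foldr (E_coord \<mu>) (sorted_list_of_set S) g"

definition L_set :: "('a::finite \<Rightarrow> real) \<Rightarrow> nat set \<Rightarrow> ((nat \<Rightarrow> 'a) \<Rightarrow> real) \<Rightarrow> ((nat \<Rightarrow> 'a) \<Rightarrow> real)" where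
  "L_set \<mu> S g = foldr (L_coord \<mu>) (sorted_list_of_set S) g"

definition level_T :: "('a::finite \<Rightarrow> real) \<Rightarrow> nat \<Rightarrow> nat set \<Rightarrow> ((nat \<Rightarrow> 'a) \<Rightarrow> real) \<Rightarrow> ((nat \<Rightarrow> 'a) \<Rightarrow> real)" where
  "level_T \<mu> n T f = E_set \<mu> ({..<n} - T) (L_set \<mu> T f)"

definition level_d :: "('a::finite \<Rightarrow> real) \<Rightarrow> nat \<Rightarrow> nat \<Rightarrow> ((nat \<Rightarrow> 'a) \<Rightarrow> real) \<Rightarrow> ((nat \<Rightarrow> 'a) \<Rightarrow> real)" where
  "level_d \<mu> n d f = (\<lambda>x. \<Sum>T\<in>{T. T \<subseteq> {..<n} \<and> card T = d}. level_T \<mu> n T f x)"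

definition Lp_norm :: "('a::finite \<Rightarrow> real) \<Rightarrow> nat set \<Rightarrow> real \<Rightarrow> ((nat \<Rightarrow> 'a) \<Rightarrow> real) \<Rightarrow> real" where
  "Lp_norm \<mu> I p g =
     (\<Sum>y\<in>PiE I (\<lambda>_. UNIV). (\<Prod>i\<in>I. \<mu> (y i)) * \<bar>g y\<bar> powr p) powr (1 / p)"

definition deriv_D :: "('a::finite \<Rightarrow> real) \<Rightarrow> nat set \<Rightarrow> (nat \<Rightarrow> 'a) \<Rightarrow> ((nat \<Rightarrow> 'a) \<Rightarrow> real) \<Rightarrow> ((nat \<Rightarrow> 'a) \<Rightarrow> real)" where
  "deriv_D \<mu> S x g = (\<lambda>y. L_set \<mu> S g (\<lambda>i. if i \<in> S then x i else y i))"

definition global_Lp_d :: "('a::finite \<Rightarrow> real) \<Rightarrow> nat \<Rightarrow> real \<Rightarrow> real \<Rightarrow> real \<Rightarrow> nat \<Rightarrow> ((nat \<Rightarrow> 'a) \<Rightarrow> real) \<Rightarrow> bool" where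
  "global_Lp_d \<mu> n p r \<gamma> d g \<longleftrightarrow>
     (\<forall>S. S \<subseteq> {..<n} \<longrightarrow> card S \<le> d \<longrightarrow>
        (\<forall>x\<in>PiE S (\<lambda>_. UNIV). Lp_norm \<mu> ({..<n} - S) p (deriv_D \<mu> S x g) \<le> r ^ card S * \<gamma>))"

definition global_L2 :: "('a::finite \<Rightarrow> real) \<Rightarrow> nat \<Rightarrow> real \<Rightarrow> real \<Rightarrow> ((nat \<Rightarrow> 'a) \<Rightarrow> real) \<Rightarrow> bool" where
  "global_L2 \<mu> n r \<gamma> g \<longleftrightarrow>
     (\<forall>S. S \<subseteq> {..<n} \<longrightarrow>
        (\<forall>x\<in>PiE S (\<lambda>_. UNIV). Lp_norm \<mu> ({..<n} - S) 2 (deriv_D \<mu> S x g) \<le> r ^ card S * \<gamma>))"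

end

theory Submission
  imports Defs
begin

text \<open>Let \<open>g\<close> be the degree \<open>d\<close> part of \<open>f\<close>, \<open>l = ln (\<gamma>2 / \<gamma>1)\<close> and \<open>m = \<lceil>l / d\<rceil>\<close>. The derivatives of \<open>g\<close> are
  the lower-degree parts of the derivatives of \<open>f\<close>, so by induction on \<open>d\<close> they are small. Hoelder's
  inequality, interpolating between the \<open>L\<^sup>1\<close> and \<open>L\<^sup>2\<close> norms of \<open>f\<close>, bounds \<open>E g\<^sup>2 = E (f g)\<close> in terms of the
  \<open>L\<^bsup>2m\<^esup>\<close> norm of \<open>g\<close>. If \<open>E g\<^sup>2\<close> exceeded the claimed bound, it would dominate the energies of
  all derivatives of \<open>g\<close>; hypercontractivity for functions with small derivatives would then bound
  \<open>E g\<^bsup>2m\<^esup>\<close> by \<open>(32 m)\<^bsup>m d\<^esup> 2\<^bsup>d\<^esup> (E g\<^sup>2)\<^bsup>m\<^esup>\<close>, and solving for \<open>E g\<^sup>2\<close> gives a contradiction.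
  The hypercontractive inequality follows one coordinate at a time from a scalar inequality.\<close>

section \<open>Products of commuting operators\<close>

text \<open>A common form of \<open>E_set\<close>, \<open>L_set\<close> and the noise operator
  \<open>T_set\<close>, so that the facts resting on commutation alone are proved once.\<close>

definition op_set :: "(nat \<Rightarrow> 'b \<Rightarrow> 'b) \<Rightarrow> nat set \<Rightarrow> 'b \<Rightarrow> 'b" where
  "op_set F S g = foldr F (sorted_list_of_set S) g"

lemma foldr_insort_commute:
  assumes "\<And>i j h. F i (F j h) = F j (F i h)"
  shows "foldr F (insort i xs) g = F i (foldr F xs g)"
  by (induction xs) (auto simp: assms)

lemma op_set_empty [simp]: "op_set F {} g = g"
  by (simp add: op_set_def)

text \<open>Sorting may put \<open>i\<close> in the middle of the list; commutation moves its factor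
  to the front. From here on the order of coordinates no longer matters.\<close>

lemma op_set_insert:
  assumes "\<And>i j h. F i (F j h) = F j (F i h)" "finite S" "i \<notin> S"
  shows "op_set F (insert i S) g = F i (op_set F S g)"
  using assms(2,3) by (simp add: op_set_def foldr_insort_commute[of F, OF assms(1)])

lemma op_set_commute:
  assumes "\<And>i j h. F i (F j h) = F j (F i h)" "finite S"
    and "\<And>i h. i \<in> S \<Longrightarrow> G (F i h) = F i (G h)"
  shows "G (op_set F S h) = op_set F S (G h)"
  using assms(2,3)
proof (induction S)
  case (insert i S)
  then show ?case by (simp add: op_set_insert[of F, OF assms(1)])
qed simp

lemma op_set_union:
  assumes "\<And>i j h. F i (F j h) = F j (F i h)" "finite S" "finite R" "S \<inter> R = {}"
  shows "op_set F (S \<union> R) h = op_set F S (op_set F R h)"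
  using assms(2,4)
proof (induction S)
  case (insert i S)
  then show ?case using \<open>finite R\<close> by (simp add: op_set_insert[of F, OF assms(1)])
qed simp

section \<open>Averaging operators\<close>

lemma E_set_op: "E_set \<mu> = op_set (E_coord \<mu>)"
  by (intro ext) (simp add: E_set_def op_set_def)

lemma L_set_op: "L_set \<mu> = op_set (L_coord \<mu>)"
  by (intro ext) (simp add: L_set_def op_set_def)

lemma E_coord_commute: "E_coord \<mu> i (E_coord \<mu> j g) = E_coord \<mu> j (E_coord \<mu> i g)"
proof (cases "i = j")
  case False
  show ?thesis
  proof
    fix x
    have "E_coord \<mu> i (E_coord \<mu> j g) x
        = (\<Sum>a\<in>UNIV. \<Sum>b\<in>UNIV. \<mu> a * (\<mu> b * g (x(i := a, j := b))))"
      by (simp add: E_coord_def sum_distrib_left)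
    also have "\<dots> = (\<Sum>b\<in>UNIV. \<Sum>a\<in>UNIV. \<mu> a * (\<mu> b * g (x(i := a, j := b))))"
      by (rule sum.swap)
    also have "\<dots> = E_coord \<mu> j (E_coord \<mu> i g) x"
      by (simp add: E_coord_def sum_distrib_left mult.left_commute fun_upd_twist[OF False])
    finally show "E_coord \<mu> i (E_coord \<mu> j g) x = E_coord \<mu> j (E_coord \<mu> i g) x" .
  qed
qed simp

lemma E_coord_add: "E_coord \<mu> i (\<lambda>x. F x + G x) = (\<lambda>x. E_coord \<mu> i F x + E_coord \<mu> i G x)"
  by (simp add: E_coord_def algebra_simps sum.distrib)

lemma E_coord_diff: "E_coord \<mu> i (\<lambda>x. F x - G x) = (\<lambda>x. E_coord \<mu> i F x - E_coord \<mu> i G x)"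
  by (simp add: E_coord_def algebra_simps sum_subtractf)

lemma E_coord_cmult: "E_coord \<mu> i (\<lambda>x. c * F x) = (\<lambda>x. c * E_coord \<mu> i F x)"
  by (simp add: E_coord_def sum_distrib_left mult_ac)

lemma E_coord_sum: "E_coord \<mu> i (\<lambda>x. \<Sum>j\<in>J. F j x) = (\<lambda>x. \<Sum>j\<in>J. E_coord \<mu> i (F j) x)"
  unfolding E_coord_def by (rule ext) (simp add: sum_distrib_left, subst sum.swap, simp)

lemma E_coord_mult_indep:
  assumes "\<And>x a. F (x(i := a)) = F x"
  shows "E_coord \<mu> i (\<lambda>x. F x * G x) = (\<lambda>x. F x * E_coord \<mu> i G x)"
  by (simp add: E_coord_def assms sum_distrib_left mult_ac)

lemma E_coord_upd [simp]: "E_coord \<mu> i F (x(i := a)) = E_coord \<mu> i F x"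
  by (simp add: E_coord_def)

lemma E_L_coord_commute: "E_coord \<mu> i (L_coord \<mu> j g) = L_coord \<mu> j (E_coord \<mu> i g)"
  by (simp add: L_coord_def E_coord_diff E_coord_commute)

lemma L_coord_commute: "L_coord \<mu> i (L_coord \<mu> j g) = L_coord \<mu> j (L_coord \<mu> i g)"
  by (rule ext) (simp add: L_coord_def E_coord_diff E_coord_commute[of \<mu> i j])

lemma L_coord_add: "L_coord \<mu> i (\<lambda>x. F x + G x) = (\<lambda>x. L_coord \<mu> i F x + L_coord \<mu> i G x)"
  by (simp add: L_coord_def E_coord_add algebra_simps)

lemma L_coord_cmult: "L_coord \<mu> i (\<lambda>x. c * F x) = (\<lambda>x. c * L_coord \<mu> i F x)"
  by (simp add: L_coord_def E_coord_cmult algebra_simps)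

lemma L_coord_sum: "L_coord \<mu> i (\<lambda>x. \<Sum>j\<in>J. F j x) = (\<lambda>x. \<Sum>j\<in>J. L_coord \<mu> i (F j) x)"
  by (simp add: L_coord_def E_coord_sum sum_subtractf)

section \<open>The noise operator and its commutation with averages\<close>

definition T_coord :: "('a::finite \<Rightarrow> real) \<Rightarrow> real \<Rightarrow> nat \<Rightarrow> ((nat \<Rightarrow> 'a) \<Rightarrow> real) \<Rightarrow> ((nat \<Rightarrow> 'a) \<Rightarrow> real)" where
  "T_coord \<mu> \<rho> i g = (\<lambda>x. E_coord \<mu> i g x + \<rho> * L_coord \<mu> i g x)"

abbreviation T_set :: "('a::finite \<Rightarrow> real) \<Rightarrow> real \<Rightarrow> nat set \<Rightarrow> ((nat \<Rightarrow> 'a) \<Rightarrow> real) \<Rightarrow> ((nat \<Rightarrow> 'a) \<Rightarrow> real)" where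
  "T_set \<mu> \<rho> \<equiv> op_set (T_coord \<mu> \<rho>)"

lemma E_T_coord_commute: "E_coord \<mu> i (T_coord \<mu> \<rho> j g) = T_coord \<mu> \<rho> j (E_coord \<mu> i g)"
  by (simp add: T_coord_def E_coord_add E_coord_cmult E_coord_commute[of \<mu> i j] E_L_coord_commute)

lemma L_T_coord_commute: "L_coord \<mu> i (T_coord \<mu> \<rho> j g) = T_coord \<mu> \<rho> j (L_coord \<mu> i g)"
  by (simp add: T_coord_def L_coord_add L_coord_cmult L_coord_commute[of \<mu> i j] E_L_coord_commute)

lemma T_coord_commute: "T_coord \<mu> \<rho> i (T_coord \<mu> \<rho> j g) = T_coord \<mu> \<rho> j (T_coord \<mu> \<rho> i g)"
  by (subst (1) T_coord_def, simp add: E_T_coord_commute L_T_coord_commute)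
     (simp add: T_coord_def E_coord_add E_coord_cmult L_coord_add L_coord_cmult E_L_coord_commute algebra_simps)

lemma T_coord_sum: "T_coord \<mu> \<rho> i (\<lambda>x. \<Sum>j\<in>J. F j x) = (\<lambda>x. \<Sum>j\<in>J. T_coord \<mu> \<rho> i (F j) x)"
  by (simp add: T_coord_def E_coord_sum L_coord_sum sum.distrib sum_distrib_left)

lemma T_coord_cmult: "T_coord \<mu> \<rho> i (\<lambda>x. c * F x) = (\<lambda>x. c * T_coord \<mu> \<rho> i F x)"
  by (simp add: T_coord_def E_coord_cmult L_coord_cmult algebra_simps)

lemmas E_set_empty = op_set_empty[of "E_coord \<mu>", folded E_set_op] for \<mu>
lemmas E_set_insert = op_set_insert[of "E_coord \<mu>", folded E_set_op, OF E_coord_commute] for \<mu>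
lemmas E_set_union = op_set_union[of "E_coord \<mu>", folded E_set_op, OF E_coord_commute] for \<mu>
lemmas L_set_empty = op_set_empty[of "L_coord \<mu>", folded L_set_op] for \<mu>
lemmas L_set_insert = op_set_insert[of "L_coord \<mu>", folded L_set_op, OF L_coord_commute] for \<mu>
lemmas L_set_union = op_set_union[of "L_coord \<mu>", folded L_set_op, OF L_coord_commute] for \<mu>
lemmas T_set_insert = op_set_insert[of "T_coord \<mu> \<rho>", OF T_coord_commute] for \<mu> \<rho>

lemma E_coord_E_set: "finite S \<Longrightarrow> E_coord \<mu> i (E_set \<mu> S g) = E_set \<mu> S (E_coord \<mu> i g)"
  unfolding E_set_op by (intro op_set_commute E_coord_commute)

lemma L_coord_E_set: "finite S \<Longrightarrow> L_coord \<mu> i (E_set \<mu> S g) = E_set \<mu> S (L_coord \<mu> i g)"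
  unfolding E_set_op by (intro op_set_commute E_coord_commute E_L_coord_commute[symmetric])

lemma E_coord_L_set: "finite S \<Longrightarrow> E_coord \<mu> i (L_set \<mu> S g) = L_set \<mu> S (E_coord \<mu> i g)"
  unfolding L_set_op by (intro op_set_commute L_coord_commute E_L_coord_commute)

lemma L_coord_L_set: "finite S \<Longrightarrow> L_coord \<mu> i (L_set \<mu> S g) = L_set \<mu> S (L_coord \<mu> i g)"
  unfolding L_set_op by (intro op_set_commute L_coord_commute)

lemma L_coord_T_set: "finite S \<Longrightarrow> L_coord \<mu> i (T_set \<mu> \<rho> S g) = T_set \<mu> \<rho> S (L_coord \<mu> i g)"
  by (intro op_set_commute T_coord_commute L_T_coord_commute)

lemma L_set_E_set: "finite S \<Longrightarrow> finite R \<Longrightarrow> L_set \<mu> R (E_set \<mu> S g) = E_set \<mu> S (L_set \<mu> R g)"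
  unfolding E_set_op by (intro op_set_commute E_coord_commute E_coord_L_set[symmetric])

lemma L_set_sum:
  "finite S \<Longrightarrow> L_set \<mu> S (\<lambda>x. \<Sum>j\<in>J. F j x) = (\<lambda>x. \<Sum>j\<in>J. L_set \<mu> S (F j) x)"
  by (induction S rule: finite_induct) (simp_all add: L_set_empty L_set_insert L_coord_sum)

lemma T_set_sum:
  "finite S \<Longrightarrow> T_set \<mu> \<rho> S (\<lambda>x. \<Sum>j\<in>J. F j x) = (\<lambda>x. \<Sum>j\<in>J. T_set \<mu> \<rho> S (F j) x)"
  by (induction S rule: finite_induct) (simp_all add: T_set_insert T_coord_sum)

context
  fixes A :: "nat set" and \<mu> :: "'a::finite \<Rightarrow> real"
  assumes fin: "finite A"
begin

lemma E_set_add: "E_set \<mu> A (\<lambda>x. F x + G x) = (\<lambda>x. E_set \<mu> A F x + E_set \<mu> A G x)"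
  using fin by (induction A) (simp_all add: E_set_empty E_set_insert E_coord_add)

lemma E_set_diff: "E_set \<mu> A (\<lambda>x. F x - G x) = (\<lambda>x. E_set \<mu> A F x - E_set \<mu> A G x)"
  using fin by (induction A) (simp_all add: E_set_empty E_set_insert E_coord_diff)

lemma E_set_cmult: "E_set \<mu> A (\<lambda>x. c * F x) = (\<lambda>x. c * E_set \<mu> A F x)"
  using fin by (induction A) (simp_all add: E_set_empty E_set_insert E_coord_cmult)

lemma E_set_sum: "E_set \<mu> A (\<lambda>x. \<Sum>j\<in>J. F j x) = (\<lambda>x. \<Sum>j\<in>J. E_set \<mu> A (F j) x)"
  using fin by (induction A) (simp_all add: E_set_empty E_set_insert E_coord_sum)

end

text \<open>The link between iterated averages and the sum over \<open>PiE\<close> in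
  \<open>Lp_norm\<close>: coordinates outside \<open>A\<close> stay frozen at \<open>x\<close>, and
  the induction splits off one coordinate of \<open>y\<close> at a time.\<close>

lemma E_set_eq_sum:
  assumes "finite A"
  shows "E_set \<mu> A F x =
    (\<Sum>y\<in>PiE A (\<lambda>_. UNIV). (\<Prod>i\<in>A. \<mu> (y i)) * F (\<lambda>i. if i \<in> A then y i else x i))"
  using assms
proof (induction A arbitrary: F x)
  case empty
  then show ?case by (simp add: E_set_empty)
next
  case (insert i A)
  have *: "(\<Prod>j\<in>A. \<mu> ((y(i := a)) j)) = (\<Prod>j\<in>A. \<mu> (y j))" for y and a :: 'a
    using insert by (intro prod.cong) auto
  have **: "(\<lambda>j. if j \<in> insert i A then (y(i := a)) j else x j) =
      (\<lambda>j. if j \<in> A then y j else (x(i := a)) j)" for y and a :: 'a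
    using insert by auto
  have inj: "inj_on (\<lambda>(y, g). g(i := y)) (UNIV \<times> (PiE A (\<lambda>_. UNIV :: 'a set)))"
    using insert by (intro inj_combinator) auto
  have "E_set \<mu> (insert i A) F x = (\<Sum>a\<in>UNIV. \<mu> a * E_set \<mu> A F (x(i := a)))"
    using insert by (simp add: E_set_insert E_coord_def)
  also have "\<dots> = (\<Sum>a\<in>UNIV. \<Sum>y\<in>PiE A (\<lambda>_. UNIV). \<mu> a * ((\<Prod>j\<in>A. \<mu> (y j)) *
       F (\<lambda>j. if j \<in> A then y j else (x(i := a)) j)))"
    by (simp add: insert.IH sum_distrib_left)
  also have "\<dots> = (\<Sum>y\<in>PiE (insert i A) (\<lambda>_. UNIV). (\<Prod>j\<in>insert i A. \<mu> (y j)) *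
       F (\<lambda>j. if j \<in> insert i A then y j else x j))"
    unfolding PiE_insert_eq sum.reindex[OF inj] o_def sum.cartesian_product
    using insert by (intro sum.cong refl, clarify, unfold ** prod.insert[OF insert.hyps] * case_prod_conv)
      (simp add: mult.assoc)
  finally show ?case .
qed

section \<open>The scalar inequality\<close>

text \<open>The graph of the convex function t^m lies above its tangent at \<open>y\<close>. For
  positive \<open>y\<close> this is Bernoulli's inequality at \<open>x / y - 1\<close>, scaled by
  \<open>y ^ m\<close>.\<close>

lemma power_ge_tangent:
  fixes x y :: real
  assumes "x \<ge> 0" "y \<ge> 0" "m \<ge> 1"
  shows "y ^ m + real m * y ^ (m - 1) * (x - y) \<le> x ^ m"
proof (cases "y = 0")
  case True
  with assms show ?thesis by (cases "m = 1") (auto simp: power_0_left)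
next
  case False
  with \<open>y \<ge> 0\<close> have "y > 0" by simp
  have "1 + real m * (x / y - 1) \<le> (1 + (x / y - 1)) ^ m"
    using assms \<open>y > 0\<close> by (intro Bernoulli_inequality) simp
  then have "y ^ m * (1 + real m * (x / y - 1)) \<le> y ^ m * (x / y) ^ m"
    using \<open>y > 0\<close> by (intro mult_left_mono) auto
  moreover have "y ^ m * (x / y) ^ m = x ^ m"
    using \<open>y > 0\<close> by (simp add: power_divide)
  moreover have "y ^ m * (1 + real m * (x / y - 1)) = y ^ m + real m * y ^ (m - 1) * (x - y)"
    using \<open>y > 0\<close> \<open>m \<ge> 1\<close> by (cases m) (simp_all add: field_simps)
  ultimately show ?thesis by simp
qed

text \<open>For nonnegative \<open>w\<close>, square the standard quadratic bound at
  \<open>w / 2\<close>, which is at most 1. For \<open>w = - v\<close> with positive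
  \<open>v\<close>, combine (1 - v + v^2)(1 + v) = 1 + v^3 \<ge> 1 with 1 + v \<le> exp v.\<close>

lemma exp_le_quadratic:
  fixes w :: real
  assumes "w \<le> 2"
  shows "exp w \<le> 1 + w + 2 * w\<^sup>2"
proof (cases "w \<ge> 0")
  case True
  have "exp (w / 2) \<le> 1 + w / 2 + (w / 2)\<^sup>2"
    using True assms by (intro exp_bound) auto
  then have "exp (w / 2) ^ 2 \<le> (1 + w / 2 + (w / 2)\<^sup>2) ^ 2"
    by (intro power_mono) auto
  also have "exp (w / 2) ^ 2 = exp w" by (simp flip: exp_double)
  also have "(1 + w / 2 + (w / 2)\<^sup>2) ^ 2 = 1 + w + w\<^sup>2 * (3 / 4 + w / 4 + w * w / 16)"
    by (simp add: power2_eq_square field_simps)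
  also have "\<dots> \<le> 1 + w + w\<^sup>2 * 2"
  proof -
    have "w * w \<le> 2 * 2" using True assms by (intro mult_mono) auto
    then have "w\<^sup>2 * (3 / 4 + w / 4 + w * w / 16) \<le> w\<^sup>2 * 2"
      using True assms by (intro mult_left_mono) auto
    then show ?thesis by simp
  qed
  finally show ?thesis by simp
next
  case False
  define v where "v = - w"
  have "v > 0" using False by (simp add: v_def)
  have "1 \<le> (1 - v + v\<^sup>2) * (1 + v)"
    using \<open>v > 0\<close> by (simp add: power2_eq_square algebra_simps)
  also have "\<dots> \<le> (1 - v + v\<^sup>2) * exp v"
  proof (intro mult_left_mono exp_ge_add_one_self)
    have "1 - v + v\<^sup>2 = (v - 1 / 2)\<^sup>2 + 3 / 4" by (simp add: power2_eq_square algebra_simps)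
    then show "1 - v + v\<^sup>2 \<ge> 0" by simp
  qed
  finally have "exp (- v) \<le> 1 - v + v\<^sup>2"
    by (simp add: exp_minus field_simps)
  then show ?thesis by (simp add: v_def) (smt (verit) zero_le_power2)
qed

text \<open>The case \<alpha> = 1 of the next lemma. The term linear in \<open>u\<close> is kept
  exactly, because later it averages to zero; only the remaining terms are estimated
  generously.\<close>

lemma power_expansion_normalized:
  fixes \<rho> u \<tau> :: real
  assumes "m \<ge> 2" "\<rho> \<ge> 0" "\<rho>\<^sup>2 = 1 / (32 * real m)" "\<tau> \<ge> 0" "u\<^sup>2 \<le> \<tau>"
  shows "(1 + 2 * \<rho> * u + \<rho>\<^sup>2 * \<tau>) ^ m
    \<le> 1 + 2 * real m * \<rho> * u + real m * \<tau> + (real m / 8) ^ m * \<tau> ^ m"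
proof -
  define X where "X = 2 * \<rho> * u + \<rho>\<^sup>2 * \<tau>"
  define v where "v = real m * \<rho> * u"
  have m2: "real m \<ge> 2" using assms(1) by simp
  have r1: "real m * \<rho>\<^sup>2 = 1 / 32" using m2 assms(3) by simp
  have ru: "(\<rho> * u)\<^sup>2 \<le> \<rho>\<^sup>2 * \<tau>"
    unfolding power_mult_distrib using assms by (intro mult_left_mono) auto
  have v2: "v\<^sup>2 \<le> real m * \<tau> / 32"
  proof -
    have "v\<^sup>2 = (real m)\<^sup>2 * (\<rho> * u)\<^sup>2" by (simp add: v_def power_mult_distrib)
    also have "\<dots> \<le> (real m)\<^sup>2 * (\<rho>\<^sup>2 * \<tau>)" using ru by (intro mult_left_mono) auto
    also have "\<dots> = real m * (real m * \<rho>\<^sup>2) * \<tau>" by (simp add: power2_eq_square)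
    also have "\<dots> = real m * \<tau> / 32" unfolding r1 by simp
    finally show ?thesis .
  qed
  have mX: "real m * X = 2 * v + \<tau> / 32"
  proof -
    have "real m * X = 2 * v + (real m * \<rho>\<^sup>2) * \<tau>" by (simp add: X_def v_def algebra_simps)
    then show ?thesis by (simp add: r1)
  qed
  have pos: "1 + X \<ge> 0"
  proof -
    have "0 \<le> (1 + \<rho> * u)\<^sup>2" by simp
    also have "\<dots> = 1 + 2 * \<rho> * u + (\<rho> * u)\<^sup>2" by (simp add: power2_eq_square algebra_simps)
    also have "\<dots> \<le> 1 + X" using ru by (simp add: X_def)
    finally show ?thesis .
  qed
  have mt: "2 * \<tau> \<le> real m * \<tau>" using m2 assms by (intro mult_right_mono) auto
  \<comment> \<open>The threshold 20 balances two regimes. Above it, \<open>1 + X\<close> is at most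
    2 + m\<tau>/64, hence at most m\<tau>/8, so the last term absorbs the power. Below it,
    \<open>v \<le> 4 / 5\<close> and \<open>\<tau> \<le> 10\<close> give
    \<open>real m * X \<le> 2\<close>, so (1 + X)^m \<le> exp(mX) and the quadratic bound on exp
    applies.\<close>
  have "(1 + X) ^ m \<le> 1 + 2 * v + real m * \<tau> + (real m / 8 * \<tau>) ^ m"
  proof (cases "real m * \<tau> \<ge> 20")
    case True
    have "1 + X \<le> real m / 8 * \<tau>"
    proof -
      have "2 * (\<rho> * u) \<le> 1 + (\<rho> * u)\<^sup>2"
        using zero_le_power2[of "\<rho> * u - 1"] by (simp add: power2_eq_square algebra_simps)
      moreover have "X = 2 * (\<rho> * u) + \<rho>\<^sup>2 * \<tau>" by (simp add: X_def)
      ultimately have "X \<le> 1 + 2 * (\<rho>\<^sup>2 * \<tau>)" using ru by linarith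
      moreover have "\<rho>\<^sup>2 * \<tau> \<le> (1 / 64) * \<tau>"
        using m2 assms(4) unfolding assms(3) by (intro mult_right_mono) (auto simp: field_simps)
      ultimately show ?thesis using True mt by simp
    qed
    then have "(1 + X) ^ m \<le> (real m / 8 * \<tau>) ^ m" using pos by (intro power_mono)
    moreover have "0 \<le> 1 + 2 * v + real m * \<tau>"
    proof -
      have "- (2 * v) \<le> 1 + v\<^sup>2"
        using zero_le_power2[of "v + 1"] by (simp add: power2_eq_square algebra_simps)
      then show ?thesis using v2 mt assms(4) by linarith
    qed
    ultimately show ?thesis by linarith
  next
    case False
    have "\<tau> \<le> 10" using mt False by simp
    have "v\<^sup>2 \<le> (4 / 5)\<^sup>2" using v2 False by (simp add: power2_eq_square)
    then have "v \<le> 4 / 5" by (rule power2_le_imp_le) simp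
    have le2: "real m * X \<le> 2" using mX \<open>v \<le> 4 / 5\<close> \<open>\<tau> \<le> 10\<close> by simp
    have "(1 + X) ^ m \<le> exp X ^ m" using pos by (intro power_mono exp_ge_add_one_self) auto
    also have "\<dots> = exp (real m * X)" by (simp add: exp_of_nat_mult)
    also have "\<dots> \<le> 1 + real m * X + 2 * (real m * X)\<^sup>2" by (rule exp_le_quadratic[OF le2])
    also have "(real m * X)\<^sup>2 \<le> 2 * (2 * v)\<^sup>2 + 2 * (\<tau> / 32)\<^sup>2"
      unfolding mX using zero_le_power2[of "2 * v - \<tau> / 32"]
      by (simp add: power2_eq_square algebra_simps)
    also have "2 * (2 * v)\<^sup>2 + 2 * (\<tau> / 32)\<^sup>2 \<le> real m * \<tau> / 4 + \<tau> / 48"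
    proof -
      have "\<tau> * \<tau> \<le> 10 * \<tau>" using \<open>\<tau> \<le> 10\<close> assms(4) by (intro mult_right_mono)
      then show ?thesis using v2 assms(4) by (simp add: power2_eq_square)
    qed
    finally have "(1 + X) ^ m \<le> 1 + real m * X + 2 * (real m * \<tau> / 4 + \<tau> / 48)" by simp
    also have "\<dots> \<le> 1 + 2 * v + real m * \<tau>"
    proof -
      have "1 + (2 * v + \<tau> / 32) + 2 * (p / 4 + \<tau> / 48) \<le> 1 + 2 * v + p" if "2 * \<tau> \<le> p" for p
        using that assms(4) by simp
      from this[OF mt] show ?thesis unfolding mX .
    qed
    also have "\<dots> \<le> 1 + 2 * v + real m * \<tau> + (real m / 8 * \<tau>) ^ m"
      using assms(4) by simp
    finally show ?thesis .
  qed
  then show ?thesis unfolding power_mult_distrib by (simp add: X_def v_def algebra_simps)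
qed

text \<open>Think of \<open>\<alpha>\<close>, \<open>u\<close>, \<open>\<tau>\<close> as the inner
  products (a,a), (a,b), (b,b) of two vectors: the left side is the 2m-th power of the norm of a +
  \<rho>b, and the last hypothesis is Cauchy-Schwarz. Dividing by \<open>\<alpha> ^ m\<close>
  reduces to the normalized case. If \<open>\<alpha> = 0\<close>, then \<open>u = 0\<close> is
  forced and \<open>\<rho>\<^sup>2 \<le> real m / 8\<close> suffices.\<close>

lemma power_expansion_bound:
  fixes \<rho> \<alpha> u \<tau> :: real
  assumes "m \<ge> 2" "\<rho> \<ge> 0" "\<rho>\<^sup>2 = 1 / (32 * real m)" "\<alpha> \<ge> 0" "\<tau> \<ge> 0" "u\<^sup>2 \<le> \<alpha> * \<tau>"
  shows "(\<alpha> + 2 * \<rho> * u + \<rho>\<^sup>2 * \<tau>) ^ m \<le> \<alpha> ^ m + 2 * real m * \<rho> * \<alpha> ^ (m - 1) * u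
    + real m * \<alpha> ^ (m - 1) * \<tau> + (real m / 8) ^ m * \<tau> ^ m"
proof (cases "\<alpha> = 0")
  case True
  have "(\<rho>\<^sup>2 * \<tau>) ^ m \<le> ((real m / 8) * \<tau>) ^ m"
  proof (intro power_mono mult_right_mono)
    have "\<rho>\<^sup>2 \<le> 1 / 64" using assms(1) unfolding assms(3) by (intro frac_le) auto
    then show "\<rho>\<^sup>2 \<le> real m / 8" using assms(1) by simp
  qed (use assms in auto)
  then show ?thesis using True assms(1,6) power_mult_distrib[of "real m / 8" \<tau> m] by (simp add: power_0_left)
next
  case False
  with assms have "\<alpha> > 0" by simp
  have "(u / \<alpha>)\<^sup>2 \<le> \<tau> / \<alpha>"
    using \<open>\<alpha> > 0\<close> assms(6) by (simp add: power_divide power2_eq_square field_simps)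
  then have "(1 + 2 * \<rho> * (u / \<alpha>) + \<rho>\<^sup>2 * (\<tau> / \<alpha>)) ^ m \<le> 1 + 2 * real m * \<rho> * (u / \<alpha>)
      + real m * (\<tau> / \<alpha>) + (real m / 8) ^ m * (\<tau> / \<alpha>) ^ m"
    using assms \<open>\<alpha> > 0\<close> by (intro power_expansion_normalized) auto
  then have "\<alpha> ^ m * (1 + 2 * \<rho> * (u / \<alpha>) + \<rho>\<^sup>2 * (\<tau> / \<alpha>)) ^ m
      \<le> \<alpha> ^ m * (1 + 2 * real m * \<rho> * (u / \<alpha>) + real m * (\<tau> / \<alpha>) + (real m / 8) ^ m * (\<tau> / \<alpha>) ^ m)"
    using \<open>\<alpha> > 0\<close> by (intro mult_left_mono) auto
  also have "\<alpha> ^ m * (1 + 2 * \<rho> * (u / \<alpha>) + \<rho>\<^sup>2 * (\<tau> / \<alpha>)) ^ m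
      = (\<alpha> + 2 * \<rho> * u + \<rho>\<^sup>2 * \<tau>) ^ m"
    using \<open>\<alpha> > 0\<close> by (simp add: field_simps flip: power_mult_distrib)
  also have "\<alpha> ^ m * (1 + 2 * real m * \<rho> * (u / \<alpha>) + real m * (\<tau> / \<alpha>) + (real m / 8) ^ m * (\<tau> / \<alpha>) ^ m)
      = \<alpha> ^ m + 2 * real m * \<rho> * \<alpha> ^ (m - 1) * u
      + real m * \<alpha> ^ (m - 1) * \<tau> + (real m / 8) ^ m * \<tau> ^ m"
  proof -
    have "\<alpha> ^ m = \<alpha> * \<alpha> ^ (m - 1)" using assms(1) by (cases m) auto
    then have "\<alpha> ^ m * (u / \<alpha>) = \<alpha> ^ (m - 1) * u" "\<alpha> ^ m * (\<tau> / \<alpha>) = \<alpha> ^ (m - 1) * \<tau>"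
      using \<open>\<alpha> > 0\<close> by simp_all
    moreover have "\<alpha> ^ m * (\<tau> / \<alpha>) ^ m = \<tau> ^ m" using \<open>\<alpha> > 0\<close> by (simp add: power_divide)
    moreover have "p * (1 + 2 * real m * \<rho> * x + real m * y + k * w)
        = p + 2 * real m * \<rho> * (p * x) + real m * (p * y) + k * (p * w)" for p x y k w :: real
      by (simp add: algebra_simps)
    ultimately show ?thesis by (simp only: mult.assoc)
  qed
  finally show ?thesis .
qed

section \<open>Hypercontractivity\<close>

locale prob_space_weights =
  fixes \<mu> :: "'a::finite \<Rightarrow> real"
  assumes weights: "prob_weights \<mu>"
begin

abbreviation "EC \<equiv> E_coord \<mu>"
abbreviation "LC \<equiv> L_coord \<mu>"
abbreviation "TC \<equiv> T_coord \<mu>"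
abbreviation "E \<equiv> E_set \<mu>"
abbreviation "L \<equiv> L_set \<mu>"
abbreviation "T \<equiv> T_set \<mu>"

lemma weight_nonneg [simp]: "\<mu> a \<ge> 0"
  using weights by (simp add: prob_weights_def)

lemma weight_sum: "sum \<mu> UNIV = 1"
  using weights by (simp add: prob_weights_def)

lemma EC_mono: "(\<And>x. F x \<le> G x) \<Longrightarrow> EC i F x \<le> EC i G x"
  by (simp add: E_coord_def sum_mono mult_left_mono)

lemma EC_indep: "(\<And>x a. F (x(i := a)) = F x) \<Longrightarrow> EC i F = F"
  by (simp add: E_coord_def weight_sum flip: sum_distrib_right)

lemma EC_EC [simp]: "EC i (EC i F) = EC i F"
  by (intro EC_indep) simp

lemma EC_LC [simp]: "EC i (LC i F) = (\<lambda>x. 0)"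
  by (simp add: L_coord_def E_coord_diff)

lemma LC_EC [simp]: "LC i (EC i F) = (\<lambda>x. 0)"
  by (simp add: L_coord_def)

lemma LC_LC [simp]: "LC i (LC i F) = LC i F"
  by (subst (1) L_coord_def) simp

lemma EC_zero [simp]: "EC i (\<lambda>x. 0) = (\<lambda>x. 0)"
  by (simp add: E_coord_def)

lemma LC_zero [simp]: "LC i (\<lambda>x. 0) = (\<lambda>x. 0)"
  by (simp add: L_coord_def)

lemma E_zero [simp]: "finite A \<Longrightarrow> E A (\<lambda>x. 0) = (\<lambda>x. 0)"
  by (induction A rule: finite_induct) (simp_all add: E_set_empty E_set_insert)

lemma L_zero [simp]: "finite A \<Longrightarrow> L A (\<lambda>x. 0) = (\<lambda>x. 0)"
  by (induction A rule: finite_induct) (simp_all add: L_set_empty L_set_insert)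

lemma E_const [simp]: "finite A \<Longrightarrow> E A (\<lambda>x. c) = (\<lambda>x. c)"
  by (induction A rule: finite_induct) (simp_all add: E_set_empty E_set_insert EC_indep)

section \<open>Positivity, Cauchy-Schwarz and Jensen for partial averages\<close>

lemma E_mono:
  assumes "finite A" "\<And>x. F x \<le> G x"
  shows "E A F x \<le> E A G x"
  using assms(1)
proof (induction A arbitrary: x)
  case empty
  then show ?case by (simp add: E_set_empty assms(2))
next
  case (insert i A)
  then show ?case by (auto simp: E_set_insert intro!: EC_mono)
qed

lemma E_nonneg: "finite A \<Longrightarrow> (\<And>x. F x \<ge> 0) \<Longrightarrow> E A F x \<ge> 0"
  using E_mono[of A "\<lambda>x. 0" F] by simp

lemma E_upd:
  assumes "finite A" "i \<in> A"
  shows "E A F (x(i := a)) = E A F x"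
proof -
  obtain B where "A = insert i B" "i \<notin> B" using assms(2) by (metis mk_disjoint_insert)
  then show ?thesis using assms by (simp add: E_set_insert)
qed

lemma EC_upd_indep:
  assumes "\<And>x a. F (x(j := a)) = F x"
  shows "EC i F (x(j := a)) = EC i F x"
  using assms by (cases "i = j") (simp_all add: E_coord_def fun_upd_twist[of j i])

lemma E_upd_indep:
  assumes "finite A" "\<And>x a. F (x(j := a)) = F x"
  shows "E A F (x(j := a)) = E A F x"
  using assms(1)
proof (induction A arbitrary: x a)
  case (insert i A)
  then show ?case unfolding E_set_insert[OF insert.hyps] by (intro EC_upd_indep insert.IH)
qed (simp add: E_set_empty assms(2))

lemma E_mult_indep:
  assumes "finite A" "\<And>x i a. i \<in> A \<Longrightarrow> F (x(i := a)) = F x"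
  shows "E A (\<lambda>x. F x * G x) = (\<lambda>x. F x * E A G x)"
  using assms
  by (induction A rule: finite_induct) (simp_all add: E_set_empty E_set_insert E_coord_mult_indep)

text \<open>The average of (sF + tG)^2 is a nonnegative quadratic form in (s,t). Evaluating it at
  (R,-Q) or (-Q,P) gives the claim when R or P is positive; if both vanish, (1,1) and (1,-1) force Q
  = 0.\<close>

lemma Cauchy_Schwarz_E:
  assumes "finite A"
  shows "(E A (\<lambda>x. F x * G x) z)\<^sup>2 \<le> E A (\<lambda>x. (F x)\<^sup>2) z * E A (\<lambda>x. (G x)\<^sup>2) z"
proof -
  define P Q R where "P = E A (\<lambda>x. (F x)\<^sup>2) z" and "Q = E A (\<lambda>x. F x * G x) z"
    and "R = E A (\<lambda>x. (G x)\<^sup>2) z"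
  have nn: "P \<ge> 0" "R \<ge> 0" unfolding P_def R_def using assms by (auto intro: E_nonneg)
  have quad: "s\<^sup>2 * P + 2 * s * t * Q + t\<^sup>2 * R \<ge> 0" for s t
  proof -
    have "0 \<le> E A (\<lambda>x. (s * F x + t * G x)\<^sup>2) z" using assms by (auto intro: E_nonneg)
    also have "(\<lambda>x. (s * F x + t * G x)\<^sup>2) =
        (\<lambda>x. s\<^sup>2 * (F x)\<^sup>2 + 2 * s * t * (F x * G x) + t\<^sup>2 * (G x)\<^sup>2)"
      by (simp add: power2_eq_square algebra_simps)
    finally show ?thesis
      using assms by (simp add: E_set_add E_set_cmult P_def Q_def R_def)
  qed
  consider "R > 0" | "R = 0" "P > 0" | "P = 0" "R = 0" using nn by linarith
  then have "Q\<^sup>2 \<le> P * R"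
  proof cases
    case 1
    have "R * (P * R - Q\<^sup>2) \<ge> 0"
      using quad[of R "- Q"] by (simp add: power2_eq_square algebra_simps)
    with 1 show ?thesis by (simp add: zero_le_mult_iff)
  next
    case 2
    have "P * (P * R - Q\<^sup>2) \<ge> 0"
      using quad[of "- Q" P] by (simp add: power2_eq_square algebra_simps)
    with \<open>P > 0\<close> show ?thesis by (simp add: zero_le_mult_iff)
  next
    case 3
    then show ?thesis using quad[of 1 1] quad[of 1 "-1"] by simp
  qed
  then show ?thesis by (simp add: P_def Q_def R_def)
qed

text \<open>Jensen's inequality for t^m under the measure weighted by \<open>F\<close>: average the
  tangent inequality, multiplied by \<open>F\<close>, and take the tangent at the weighted mean of
  \<open>G\<close>. If the total weight is 0, the tangent point is free, and a large one forces the
  average of \<open>F * G\<close> to vanish.\<close>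

lemma power_mean_E:
  assumes "finite A" "\<And>x. F x \<ge> 0" "\<And>x. G x \<ge> 0" "m \<ge> 1"
  shows "(E A (\<lambda>x. F x * G x) z) ^ m \<le> (E A F z) ^ (m - 1) * E A (\<lambda>x. F x * G x ^ m) z"
proof (cases "m = 1")
  case False
  define P Q where "P = E A F z" and "Q = E A (\<lambda>x. F x * G x) z"
  define R where "R = E A (\<lambda>x. F x * G x ^ m) z"
  have nn: "P \<ge> 0" "Q \<ge> 0" "R \<ge> 0"
    unfolding P_def Q_def R_def using assms by (auto intro!: E_nonneg)
  have tangent: "y ^ m * P + real m * y ^ (m - 1) * (Q - y * P) \<le> R" if "y \<ge> 0" for y
  proof -
    have "(y ^ m - real m * y ^ (m - 1) * y) * P + real m * y ^ (m - 1) * Q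
        = E A (\<lambda>x. (y ^ m - real m * y ^ (m - 1) * y) * F x + real m * y ^ (m - 1) * (F x * G x)) z"
      using assms(1) by (simp only: E_set_add E_set_cmult P_def Q_def)
    also have "\<dots> \<le> R"
      unfolding R_def
    proof (rule E_mono[OF assms(1)])
      fix x
      have "F x * (y ^ m + real m * y ^ (m - 1) * (G x - y)) \<le> F x * G x ^ m"
        using assms that by (intro mult_left_mono power_ge_tangent) auto
      then show "(y ^ m - real m * y ^ (m - 1) * y) * F x + real m * y ^ (m - 1) * (F x * G x)
          \<le> F x * G x ^ m"
        by (simp add: algebra_simps)
    qed
    finally show ?thesis by (simp add: algebra_simps)
  qed
  have "Q ^ m \<le> P ^ (m - 1) * R"
  proof (cases "P = 0")
    case True
    have "Q = 0"
    proof (rule ccontr)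
      assume "Q \<noteq> 0"
      with nn have "Q > 0" by simp
      \<comment> \<open>With P = 0 the tangent bound reads m y^(m-1) Q \<le> R for every nonnegative
        y. This choice makes yQ = R + Q, which is larger than R.\<close>
      define y where "y = R / Q + 1"
      have "y \<ge> 1" using nn \<open>Q > 0\<close> by (simp add: y_def)
        have "y \<le> real m * y ^ (m - 1)"
        proof -
          have "y ^ 1 \<le> y ^ (m - 1)" using \<open>m \<noteq> 1\<close> \<open>m \<ge> 1\<close> \<open>y \<ge> 1\<close> by (intro power_increasing) auto
          also have "1 * y ^ (m - 1) \<le> real m * y ^ (m - 1)"
            using \<open>m \<ge> 1\<close> \<open>y \<ge> 1\<close> by (intro mult_right_mono) auto
          finally show ?thesis by simp
        qed
        then have "y * Q \<le> real m * y ^ (m - 1) * Q" using nn by (intro mult_right_mono)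
        also have "\<dots> \<le> R" using tangent[of y] \<open>y \<ge> 1\<close> True by simp
        finally show False using \<open>Q > 0\<close> by (auto simp: y_def field_simps mult_le_0_iff)
    qed
    then show ?thesis using nn \<open>m \<ge> 1\<close> by (simp add: power_0_left)
  next
    case False
    with nn have "P > 0" by simp
    have "(Q / P) ^ m * P \<le> R"
      using tangent[of "Q / P"] nn \<open>P > 0\<close> by simp
    then have "P ^ (m - 1) * ((Q / P) ^ m * P) \<le> P ^ (m - 1) * R"
      using \<open>P > 0\<close> by (intro mult_left_mono) auto
    moreover have "P ^ (m - 1) * ((Q / P) ^ m * P) = Q ^ m"
      using \<open>P > 0\<close> \<open>m \<ge> 1\<close> by (cases m) (auto simp: power_divide)
    ultimately show ?thesis by simp
  qed
  then show ?thesis by (simp add: P_def Q_def R_def)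
qed simp

text \<open>Split \<open>F\<close> into its mean \<open>a\<close> over coordinate \<open>i\<close>
  and the mean-zero rest \<open>b\<close>, with \<open>E A\<close> giving the inner product, and
  apply \<open>power_expansion_bound\<close> pointwise. Since \<alpha> does not depend on coordinate
  \<open>i\<close> and \<open>u\<close> has mean zero in it, the cross term disappears. The next two
  terms are the tangent to t^m at \<alpha>, evaluated at \<alpha> plus the mean of \<tau>, so they
  are at most the m-th power of that sum, which is the energy over
  \<open>insert i A\<close>.\<close>

lemma one_coordinate_hypercontractive:
  assumes "finite A" "i \<notin> A" "m \<ge> 2" "\<rho> \<ge> 0" "\<rho>\<^sup>2 = 1 / (32 * real m)"
  shows "EC i (\<lambda>y. (E A (\<lambda>x. (TC \<rho> i F x)\<^sup>2) y) ^ m) z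
    \<le> (E (insert i A) (\<lambda>x. (F x)\<^sup>2) z) ^ m
      + (real m / 8) ^ m * EC i (\<lambda>y. (E A (\<lambda>x. (LC i F x)\<^sup>2) y) ^ m) z"
proof -
  define a b where "a = EC i F" and "b = LC i F"
  define \<alpha> u \<tau> where "\<alpha> = E A (\<lambda>x. (a x)\<^sup>2)" and "u = E A (\<lambda>x. a x * b x)"
    and "\<tau> = E A (\<lambda>x. (b x)\<^sup>2)"
  have F: "F x = a x + b x" for x by (simp add: a_def b_def L_coord_def)
  have nn: "\<alpha> y \<ge> 0" "\<tau> y \<ge> 0" for y
    unfolding \<alpha>_def \<tau>_def using assms(1) by (auto intro: E_nonneg)
  have a_ind: "a (x(i := c)) = a x" for x c by (simp add: a_def)
  have \<alpha>_ind: "\<alpha> (x(i := c)) = \<alpha> x" for x c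
    unfolding \<alpha>_def using assms(1) by (intro E_upd_indep) (simp_all add: a_ind del: fun_upd_apply)
  have u0: "EC i u = (\<lambda>x. 0)"
  proof -
    have "EC i u = E A (\<lambda>x. a x * EC i b x)"
      unfolding u_def E_coord_E_set[OF assms(1)]
      by (subst E_coord_mult_indep) (simp_all add: a_ind del: fun_upd_apply)
    then show ?thesis using assms(1) by (simp add: b_def)
  qed
  have sq: "E A (\<lambda>x. (a x + s * b x)\<^sup>2) = (\<lambda>y. \<alpha> y + 2 * s * u y + s\<^sup>2 * \<tau> y)" for s
  proof -
    have "(\<lambda>x. (a x + s * b x)\<^sup>2) = (\<lambda>x. (a x)\<^sup>2 + 2 * s * (a x * b x) + s\<^sup>2 * (b x)\<^sup>2)"
      by (simp add: power2_eq_square algebra_simps)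
    then show ?thesis
      using assms(1) by (simp only: E_set_add E_set_cmult \<alpha>_def u_def \<tau>_def)
  qed
  have "EC i (\<lambda>y. (E A (\<lambda>x. (TC \<rho> i F x)\<^sup>2) y) ^ m) z
      = EC i (\<lambda>y. (\<alpha> y + 2 * \<rho> * u y + \<rho>\<^sup>2 * \<tau> y) ^ m) z"
    by (simp only: T_coord_def sq flip: a_def b_def)
  also have "\<dots> \<le> EC i (\<lambda>y. \<alpha> y ^ m + (2 * real m * \<rho>) * (\<alpha> y ^ (m - 1) * u y)
      + real m * (\<alpha> y ^ (m - 1) * \<tau> y) + (real m / 8) ^ m * \<tau> y ^ m) z"
  proof (rule EC_mono)
    fix y
    have "(u y)\<^sup>2 \<le> \<alpha> y * \<tau> y"
      unfolding u_def \<alpha>_def \<tau>_def by (rule Cauchy_Schwarz_E[OF assms(1)])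
    from power_expansion_bound[OF assms(3-5) nn this]
    show "(\<alpha> y + 2 * \<rho> * u y + \<rho>\<^sup>2 * \<tau> y) ^ m \<le> \<alpha> y ^ m + (2 * real m * \<rho>) * (\<alpha> y ^ (m - 1) * u y)
      + real m * (\<alpha> y ^ (m - 1) * \<tau> y) + (real m / 8) ^ m * \<tau> y ^ m"
      by (simp add: mult_ac)
  qed
  also have "\<dots> = \<alpha> z ^ m + real m * (\<alpha> z ^ (m - 1) * EC i \<tau> z)
      + (real m / 8) ^ m * EC i (\<lambda>y. \<tau> y ^ m) z"
  proof -
    have "EC i (\<lambda>y. \<alpha> y ^ m) = (\<lambda>y. \<alpha> y ^ m)"
      by (rule EC_indep) (simp add: \<alpha>_ind del: fun_upd_apply)
    moreover have "EC i (\<lambda>y. \<alpha> y ^ (m - 1) * G y) = (\<lambda>y. \<alpha> y ^ (m - 1) * EC i G y)" for G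
      by (rule E_coord_mult_indep) (simp add: \<alpha>_ind del: fun_upd_apply)
    ultimately show ?thesis
      by (simp add: E_coord_add E_coord_cmult u0)
  qed
  also have "\<alpha> z ^ m + real m * (\<alpha> z ^ (m - 1) * EC i \<tau> z) \<le> (\<alpha> z + EC i \<tau> z) ^ m"
  proof -
    have "EC i \<tau> z \<ge> 0" using nn EC_mono[of "\<lambda>x. 0" \<tau>] by simp
    then show ?thesis
      using power_ge_tangent[of "\<alpha> z + EC i \<tau> z" "\<alpha> z" m] nn assms(3) by (simp add: mult.assoc)
  qed
  also have "\<alpha> z + EC i \<tau> z = E (insert i A) (\<lambda>x. (F x)\<^sup>2) z"
  proof -
    have "EC i \<alpha> = \<alpha>" by (rule EC_indep) (rule \<alpha>_ind)
    moreover have "E (insert i A) (\<lambda>x. (F x)\<^sup>2) = EC i (\<lambda>y. \<alpha> y + 2 * u y + \<tau> y)"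
      using sq[of 1] assms(1,2) by (simp add: E_set_insert F)
    ultimately show ?thesis by (simp add: E_coord_add E_coord_cmult u0)
  qed
  finally show ?thesis by (simp add: \<tau>_def b_def)
qed

text \<open>The set \<open>A\<close> collects the coordinates already treated, in which only an \<open>L\<^sup>2\<close> norm is
  taken; it plays the role of a Hilbert space of values and makes the induction on \<open>B\<close> possible.\<close>

lemma hypercontractive:
  assumes "finite B" "finite A" "A \<inter> B = {}" "m \<ge> 2" "\<rho> \<ge> 0" "\<rho>\<^sup>2 = 1 / (32 * real m)"
  shows "E B (\<lambda>y. (E A (\<lambda>x. (T \<rho> B f x)\<^sup>2) y) ^ m) z
    \<le> (\<Sum>S\<in>Pow B. ((real m / 8) ^ m) ^ card S *
          E S (\<lambda>y. (E (A \<union> (B - S)) (\<lambda>x. (L S f x)\<^sup>2) y) ^ m) z)"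
  using assms(1-3)
proof (induction B arbitrary: A f z)
  case empty
  then show ?case by (simp add: E_set_empty L_set_empty)
next
  case (insert i B)
  define \<Lambda> where "\<Lambda> = (real m / 8) ^ m"
  have \<Lambda>: "\<Lambda> \<ge> 0" by (simp add: \<Lambda>_def)
  define H where "H f A S = E S (\<lambda>y. (E A (\<lambda>x. (L S f x)\<^sup>2) y) ^ m)" for f A S
  have iA: "i \<notin> A" using insert by auto
  have fS: "finite S" if "S \<in> Pow B" for S using that insert.hyps finite_subset by auto
  have "E (insert i B) (\<lambda>y. (E A (\<lambda>x. (T \<rho> (insert i B) f x)\<^sup>2) y) ^ m) z
      = E B (EC i (\<lambda>y. (E A (\<lambda>x. (TC \<rho> i (T \<rho> B f) x)\<^sup>2) y) ^ m)) z"
    using insert.hyps by (simp add: E_set_insert E_coord_E_set T_set_insert)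
  \<comment> \<open>One coordinate leaves \<open>B\<close> in two ways: either \<open>i\<close>
    joins the coordinates averaged in L2, or a derivative in \<open>i\<close> is taken at the cost
    of a factor \<Lambda>.\<close>
  also have "\<dots> \<le> E B (\<lambda>y. (E (insert i A) (\<lambda>x. (T \<rho> B f x)\<^sup>2) y) ^ m
      + \<Lambda> * EC i (\<lambda>y. (E A (\<lambda>x. (LC i (T \<rho> B f) x)\<^sup>2) y) ^ m) y) z"
    unfolding \<Lambda>_def using insert iA assms(4-6)
    by (intro E_mono one_coordinate_hypercontractive) auto
  also have "\<dots> = E B (\<lambda>y. (E (insert i A) (\<lambda>x. (T \<rho> B f x)\<^sup>2) y) ^ m) z
      + \<Lambda> * EC i (E B (\<lambda>y. (E A (\<lambda>x. (T \<rho> B (LC i f) x)\<^sup>2) y) ^ m)) z"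
    using insert.hyps by (simp add: E_set_add E_set_cmult E_coord_E_set L_coord_T_set)
  \<comment> \<open>The induction hypothesis is used twice: for \<open>f\<close> with
    \<open>insert i A\<close>, which yields the sets S without \<open>i\<close>, and for
    \<open>LC i f\<close> with \<open>A\<close>, which after reindexing yields the sets S containing
    \<open>i\<close>.\<close>
  also have "\<dots> \<le> (\<Sum>S\<in>Pow B. \<Lambda> ^ card S * H f (insert i A \<union> (B - S)) S z)
      + \<Lambda> * EC i (\<lambda>z. \<Sum>S\<in>Pow B. \<Lambda> ^ card S * H (LC i f) (A \<union> (B - S)) S z) z"
    unfolding \<Lambda>_def H_def using insert.prems insert.hyps
    by (intro add_mono mult_left_mono EC_mono insert.IH) auto
  also have "(\<Sum>S\<in>Pow B. \<Lambda> ^ card S * H f (insert i A \<union> (B - S)) S z)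
      = (\<Sum>S\<in>Pow B. \<Lambda> ^ card S * H f (A \<union> (insert i B - S)) S z)"
  proof (intro sum.cong refl)
    fix S assume "S \<in> Pow B"
    then have "insert i A \<union> (B - S) = A \<union> (insert i B - S)" using insert.hyps by auto
    then show "\<Lambda> ^ card S * H f (insert i A \<union> (B - S)) S z = \<Lambda> ^ card S * H f (A \<union> (insert i B - S)) S z"
      by simp
  qed
  also have "\<Lambda> * EC i (\<lambda>z. \<Sum>S\<in>Pow B. \<Lambda> ^ card S * H (LC i f) (A \<union> (B - S)) S z) z
      = (\<Sum>S\<in>insert i ` Pow B. \<Lambda> ^ card S * H f (A \<union> (insert i B - S)) S z)"
  proof -
    have inj: "inj_on (insert i) (Pow B)" using insert.hyps by (auto simp: inj_on_def)
    have "\<Lambda> * EC i (\<lambda>z. \<Sum>S\<in>Pow B. \<Lambda> ^ card S * H (LC i f) (A \<union> (B - S)) S z) z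
        = (\<Sum>S\<in>Pow B. \<Lambda> * (\<Lambda> ^ card S * EC i (H (LC i f) (A \<union> (B - S)) S) z))"
      by (simp add: E_coord_sum E_coord_cmult sum_distrib_left)
    also have "\<dots> = (\<Sum>S\<in>Pow B. \<Lambda> ^ card (insert i S) * H f (A \<union> (insert i B - insert i S)) (insert i S) z)"
    proof (intro sum.cong refl)
      fix S assume S: "S \<in> Pow B"
      then have "i \<notin> S" "insert i B - insert i S = B - S" using insert.hyps by auto
      then show "\<Lambda> * (\<Lambda> ^ card S * EC i (H (LC i f) (A \<union> (B - S)) S) z)
          = \<Lambda> ^ card (insert i S) * H f (A \<union> (insert i B - insert i S)) (insert i S) z"
        using fS[OF S] by (simp add: H_def E_set_insert L_set_insert L_coord_L_set)
    qed
    finally show ?thesis by (simp add: sum.reindex[OF inj])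
  qed
  also have "(\<Sum>S\<in>Pow B. \<Lambda> ^ card S * H f (A \<union> (insert i B - S)) S z)
      + (\<Sum>S\<in>insert i ` Pow B. \<Lambda> ^ card S * H f (A \<union> (insert i B - S)) S z)
      = (\<Sum>S\<in>Pow (insert i B). \<Lambda> ^ card S * H f (A \<union> (insert i B - S)) S z)"
    unfolding Pow_insert using insert.hyps
    by (intro sum.union_disjoint[symmetric]) auto
  finally show ?case by (simp add: \<Lambda>_def H_def)
qed

end

section \<open>The level decomposition\<close>

lemma op_set_fixed:
  assumes "\<And>i j h. F i (F j h) = F j (F i h)" "finite S" "\<And>i. i \<in> S \<Longrightarrow> F i h = h"
  shows "op_set F S h = h"
  using assms(2,3) by (induction S) (simp_all add: op_set_insert[of F, OF assms(1)])

lemma op_set_killed: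
  assumes "\<And>i j h. F i (F j h) = F j (F i h)" "finite S" "i \<in> S" "F i h = z" "\<And>j. F j z = z"
  shows "op_set F S h = z"
proof -
  obtain R where R: "S = insert i R" "i \<notin> R" using assms(3) by (metis mk_disjoint_insert)
  with assms(2) have "finite R" by simp
  have "op_set F S h = op_set F R (F i h)"
    using R \<open>finite R\<close> assms(1)
    by (simp add: op_set_insert[of F, OF assms(1)] op_set_commute[of F, OF assms(1)])
  then show ?thesis
    using op_set_fixed[of F, OF assms(1) \<open>finite R\<close>] assms(4,5) by simp
qed

text \<open>\<open>level_T\<close> over an arbitrary coordinate set \<open>A\<close> in place of
  \<open>{..<n}\<close>: differentiating along S leaves a function of the coordinates
  \<open>A - S\<close>, on which the induction on the degree continues.\<close>

definition level_part :: "('a::finite \<Rightarrow> real) \<Rightarrow> nat set \<Rightarrow> nat set \<Rightarrow> ((nat \<Rightarrow> 'a) \<Rightarrow> real) \<Rightarrow> ((nat \<Rightarrow> 'a) \<Rightarrow> real)" where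
  "level_part \<mu> A U f = E_set \<mu> (A - U) (L_set \<mu> U f)"

definition level :: "('a::finite \<Rightarrow> real) \<Rightarrow> nat set \<Rightarrow> nat \<Rightarrow> ((nat \<Rightarrow> 'a) \<Rightarrow> real) \<Rightarrow> ((nat \<Rightarrow> 'a) \<Rightarrow> real)" where
  "level \<mu> A d f = (\<lambda>x. \<Sum>U\<in>{U. U \<subseteq> A \<and> card U = d}. level_part \<mu> A U f x)"

lemma level_d_eq_level: "level_d \<mu> n d f = level \<mu> {..<n} d f"
  by (simp add: level_d_def level_def level_T_def level_part_def)

context prob_space_weights
begin

abbreviation "Q \<equiv> level_part \<mu>"

context
  fixes A :: "nat set"
  assumes finA: "finite A"
begin

lemma finite_sub: "U \<subseteq> A \<Longrightarrow> finite U"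
  using finA finite_subset by blast

lemma level_part_coord_in:
  assumes "U \<subseteq> A" "i \<in> U"
  shows "EC i (Q A U f) = (\<lambda>x. 0)" "LC i (Q A U f) = Q A U f"
proof -
  obtain R where R: "U = insert i R" "i \<notin> R" using assms(2) by (metis mk_disjoint_insert)
  have fin: "finite R" "finite (A - U)" using R assms finite_sub finA by auto
  have "EC i (L U f) = (\<lambda>x. 0)" "LC i (L U f) = L U f"
    using R fin by (simp_all add: L_set_insert)
  then show "EC i (Q A U f) = (\<lambda>x. 0)" "LC i (Q A U f) = Q A U f"
    using fin by (simp_all add: level_part_def E_coord_E_set L_coord_E_set)
qed

lemma level_part_coord_notin:
  assumes "U \<subseteq> A" "i \<in> A - U"
  shows "EC i (Q A U f) = Q A U f" "LC i (Q A U f) = (\<lambda>x. 0)"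
proof -
  obtain R where R: "A - U = insert i R" "i \<notin> R" using assms(2) by (metis mk_disjoint_insert)
  have "finite (insert i R)" using finA by (simp flip: R)
  then show "EC i (Q A U f) = Q A U f" "LC i (Q A U f) = (\<lambda>x. 0)"
    using R by (simp_all add: level_part_def E_set_insert)
qed

lemma L_level_part:
  assumes "U \<subseteq> A" "S \<subseteq> A"
  shows "L S (Q A U f) = (if S \<subseteq> U then Q A U f else (\<lambda>x. 0))"
proof (cases "S \<subseteq> U")
  case True
  then show ?thesis unfolding L_set_op using assms
    by (simp, intro op_set_fixed L_coord_commute level_part_coord_in) (auto intro: finite_sub)
next
  case False
  then obtain i where i: "i \<in> S" "i \<in> A - U" using assms by auto
  have "L S (Q A U f) = (\<lambda>x. 0)" unfolding L_set_op
    by (rule op_set_killed[of LC, OF L_coord_commute finite_sub[OF assms(2)] i(1)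
          level_part_coord_notin(2)[OF assms(1) i(2)] LC_zero])
  with False show ?thesis by simp
qed

lemma E_level_part_zero:
  assumes "U \<subseteq> A" "S \<subseteq> A" "\<not> S \<subseteq> A - U"
  shows "E S (Q A U f) = (\<lambda>x. 0)"
proof -
  obtain i where i: "i \<in> S" "i \<in> U" using assms by auto
  show ?thesis unfolding E_set_op
    by (rule op_set_killed[of EC, OF E_coord_commute finite_sub[OF assms(2)] i(1)
          level_part_coord_in(1)[OF assms(1) i(2)] EC_zero])
qed

lemma E_level_part_fixed:
  assumes "U \<subseteq> A"
  shows "E (A - U) (Q A U f) = Q A U f"
  unfolding E_set_op using assms finA by (intro op_set_fixed E_coord_commute level_part_coord_notin) auto

text \<open>If U and V differ, some coordinate lies in exactly one of them. There one projection
  averages while the other retains only mean-zero parts, so the composition vanishes.\<close>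

lemma level_part_level_part:
  assumes "U \<subseteq> A" "V \<subseteq> A"
  shows "Q A U (Q A V f) = (if U = V then Q A U f else (\<lambda>x. 0))"
proof -
  have fin: "finite U" "finite (A - U)" using assms finite_sub by auto
  consider "U = V" | "\<not> U \<subseteq> V" | "\<not> A - U \<subseteq> A - V" using assms by auto
  then show ?thesis
  proof cases
    case 1
    then show ?thesis using assms E_level_part_fixed
      by (subst level_part_def) (simp add: L_level_part)
  next
    case 2
    then show ?thesis using assms fin by (subst level_part_def) (auto simp: L_level_part)
  next
    case 3
    have "Q A U (Q A V f) = L U (E (A - U) (Q A V f))"
      using fin by (simp add: level_part_def[of \<mu> A U] L_set_E_set)
    moreover have "U \<noteq> V" using 3 by auto
    ultimately show ?thesis using assms fin 3 by (simp add: E_level_part_zero)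
  qed
qed

text \<open>In each coordinate of \<open>U\<close> the part has mean zero and the noise multiplies
  it by \<rho>; in every other coordinate of \<open>A\<close> the part is constant and is left
  unchanged. Level parts are thus eigenfunctions of the noise operator.\<close>

lemma T_level_part:
  assumes "U \<subseteq> A"
  shows "T \<rho> A (Q A U f) = (\<lambda>x. \<rho> ^ card U * Q A U f x)"
proof -
  have T: "T \<rho> S (Q A U f) = (\<lambda>x. \<rho> ^ card (S \<inter> U) * Q A U f x)" if "finite S" "S \<subseteq> A" for S
    using that
  proof (induction S)
    case (insert i S)
    have "TC \<rho> i (Q A U f) = (\<lambda>x. (if i \<in> U then \<rho> else 1) * Q A U f x)"
      using insert.prems level_part_coord_in[OF assms, of i f] level_part_coord_notin[OF assms, of i f]
      by (auto simp: T_coord_def)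
    then show ?case using insert
      by (auto simp: T_set_insert T_coord_cmult)
  qed simp
  show ?thesis using T[OF finA order_refl] assms by (simp add: Int_absorb1)
qed

section \<open>Self-adjointness, orthogonality and energies of levels\<close>

lemma E_EC_selfadjoint:
  assumes "i \<in> A"
  shows "E A (\<lambda>x. F x * EC i G x) = E A (\<lambda>x. EC i F x * G x)"
proof -
  obtain R where R: "A = insert i R" "i \<notin> R" using assms by (metis mk_disjoint_insert)
  have "finite R" using finA R by simp
  have "EC i (\<lambda>x. F x * EC i G x) = EC i (\<lambda>x. EC i G x * F x)" by (simp add: mult.commute)
  also have "\<dots> = EC i (\<lambda>x. EC i F x * G x)"
    by (simp add: E_coord_mult_indep del: fun_upd_apply) (simp add: mult.commute)
  finally show ?thesis using R \<open>finite R\<close> by (simp add: E_set_insert E_coord_E_set)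
qed

lemma E_LC_selfadjoint:
  assumes "i \<in> A"
  shows "E A (\<lambda>x. F x * LC i G x) = E A (\<lambda>x. LC i F x * G x)"
  using E_EC_selfadjoint[OF assms, of F G] finA
  by (simp add: L_coord_def algebra_simps E_set_diff)

lemma E_E_selfadjoint:
  assumes "finite S" "S \<subseteq> A"
  shows "E A (\<lambda>x. F x * E S G x) = E A (\<lambda>x. E S F x * G x)"
  using assms
proof (induction S arbitrary: F)
  case (insert i S)
  then show ?case by (simp add: E_set_insert E_EC_selfadjoint) (simp add: E_coord_E_set)
qed (simp add: E_set_empty)

lemma E_L_selfadjoint:
  assumes "finite S" "S \<subseteq> A"
  shows "E A (\<lambda>x. F x * L S G x) = E A (\<lambda>x. L S F x * G x)"
  using assms
proof (induction S arbitrary: F)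
  case (insert i S)
  then show ?case by (simp add: L_set_insert E_LC_selfadjoint) (simp add: L_coord_L_set)
qed (simp add: L_set_empty)

lemma level_part_selfadjoint:
  assumes "U \<subseteq> A"
  shows "E A (\<lambda>x. F x * Q A U G x) = E A (\<lambda>x. Q A U F x * G x)"
proof -
  have fin: "finite U" "finite (A - U)" using assms finite_sub by auto
  show ?thesis
    using assms fin by (simp add: level_part_def E_E_selfadjoint E_L_selfadjoint L_set_E_set)
qed

lemma level_part_orthogonal:
  assumes "U \<subseteq> A" "V \<subseteq> A"
  shows "E A (\<lambda>x. Q A U f x * Q A V f x) = (if U = V then E A (\<lambda>x. (Q A U f x)\<^sup>2) else (\<lambda>x. 0))"
  using assms finA
  by (auto simp: level_part_selfadjoint level_part_level_part power2_eq_square)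

lemma E_sq_sum_level_parts:
  assumes "\<And>U. U \<in> \<U> \<Longrightarrow> U \<subseteq> A"
  shows "E A (\<lambda>x. (\<Sum>U\<in>\<U>. Q A U f x)\<^sup>2) z = (\<Sum>U\<in>\<U>. E A (\<lambda>x. (Q A U f x)\<^sup>2) z)"
proof -
  have fin: "finite \<U>"
    using assms finA by (intro finite_subset[of \<U> "Pow A"]) auto
  have "E A (\<lambda>x. (\<Sum>U\<in>\<U>. Q A U f x)\<^sup>2) z
      = (\<Sum>U\<in>\<U>. \<Sum>V\<in>\<U>. E A (\<lambda>x. Q A U f x * Q A V f x) z)"
    using finA by (simp add: power2_eq_square sum_product E_set_sum)
  also have "\<dots> = (\<Sum>U\<in>\<U>. \<Sum>V\<in>\<U>. if U = V then E A (\<lambda>x. (Q A U f x)\<^sup>2) z else 0)"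
    using assms by (intro sum.cong refl) (simp add: level_part_orthogonal)
  finally show ?thesis using fin by simp
qed

text \<open>Each level part is a self-adjoint idempotent, and different parts are orthogonal. This
  turns the energy of the level into a pairing with \<open>f\<close>, to which Hoelder's inequality
  can be applied.\<close>

lemma E_mult_level: "E A (\<lambda>x. f x * level \<mu> A d f x) z = E A (\<lambda>x. (level \<mu> A d f x)\<^sup>2) z"
proof -
  let ?\<U> = "{U. U \<subseteq> A \<and> card U = d}"
  have "E A (\<lambda>x. f x * level \<mu> A d f x) z = (\<Sum>U\<in>?\<U>. E A (\<lambda>x. f x * Q A U f x) z)"
    using finA by (simp add: level_def sum_distrib_left E_set_sum)
  also have "\<dots> = (\<Sum>U\<in>?\<U>. E A (\<lambda>x. f x * Q A U (Q A U f) x) z)"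
    by (intro sum.cong refl) (simp add: level_part_level_part)
  also have "\<dots> = (\<Sum>U\<in>?\<U>. E A (\<lambda>x. (Q A U f x)\<^sup>2) z)"
    by (intro sum.cong refl, subst level_part_selfadjoint) (simp_all add: power2_eq_square)
  also have "\<dots> = E A (\<lambda>x. (level \<mu> A d f x)\<^sup>2) z"
    unfolding level_def by (subst E_sq_sum_level_parts) auto
  finally show ?thesis .
qed

lemma T_level: "T \<rho> A (level \<mu> A d f) = (\<lambda>x. \<rho> ^ d * level \<mu> A d f x)"
  unfolding level_def T_set_sum[OF finA] sum_distrib_left
  by (intro ext sum.cong refl) (auto simp: T_level_part)

lemma L_level_eq_sum:
  assumes "S \<subseteq> A"
  shows "L S (level \<mu> A d f) = (\<lambda>x. \<Sum>U\<in>{U. U \<subseteq> A \<and> card U = d \<and> S \<subseteq> U}. Q A U f x)"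
proof -
  have "finite {U. U \<subseteq> A \<and> card U = d}" using finA by simp
  then have "(\<Sum>U\<in>{U. U \<subseteq> A \<and> card U = d}. if S \<subseteq> U then Q A U f x else 0)
      = (\<Sum>U\<in>{U. U \<subseteq> A \<and> card U = d \<and> S \<subseteq> U}. Q A U f x)" for x
    by (subst sum.inter_filter[symmetric]) (auto intro: sum.cong)
  moreover have "L S (level \<mu> A d f)
      = (\<lambda>x. \<Sum>U\<in>{U. U \<subseteq> A \<and> card U = d}. if S \<subseteq> U then Q A U f x else 0)"
    unfolding level_def L_set_sum[OF finite_sub[OF assms]]
    using assms by (intro ext sum.cong refl) (auto simp: L_level_part)
  ultimately show ?thesis by simp
qed

text \<open>\<open>L S\<close> keeps exactly the parts with U containing S, and removing S from U
  matches them with the parts of \<open>L S f\<close> over \<open>A - S\<close>. Hence derivatives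
  of a level are lower levels of derivatives, which drives the induction on
  \<open>d\<close>.\<close>

lemma L_level:
  assumes "S \<subseteq> A" "card S \<le> d"
  shows "L S (level \<mu> A d f) = level \<mu> (A - S) (d - card S) (L S f)"
proof
  fix x
  have fS: "finite S" by (rule finite_sub[OF assms(1)])
  have "(\<Sum>U\<in>{U. U \<subseteq> A \<and> card U = d \<and> S \<subseteq> U}. Q A U f x)
      = (\<Sum>V\<in>{V. V \<subseteq> A - S \<and> card V = d - card S}. Q (A - S) V (L S f) x)"
  proof (rule sum.reindex_bij_witness[where i = "\<lambda>V. V \<union> S" and j = "\<lambda>U. U - S"])
    fix U assume U: "U \<in> {U. U \<subseteq> A \<and> card U = d \<and> S \<subseteq> U}"
    then have "finite U" using finite_sub by auto
    then have "L (U - S) (L S f) = L U f"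
      using L_set_union[of "U - S" S \<mu> f] fS U by (simp add: Un_absorb2 Int_commute)
    moreover have "A - S - (U - S) = A - U" using U by auto
    ultimately show "Q (A - S) (U - S) (L S f) x = Q A U f x" by (simp add: level_part_def)
    show "U - S \<in> {V. V \<subseteq> A - S \<and> card V = d - card S}"
      using U fS by (auto simp: card_Diff_subset)
  next
    fix V assume V: "V \<in> {V. V \<subseteq> A - S \<and> card V = d - card S}"
    then have "finite V" "V \<inter> S = {}" using finite_sub[of V] by auto
    then have "card (V \<union> S) = card V + card S" using fS by (intro card_Un_disjoint)
    then show "V \<union> S \<in> {U. U \<subseteq> A \<and> card U = d \<and> S \<subseteq> U}" using V assms by auto
    show "V \<union> S - S = V" using \<open>V \<inter> S = {}\<close> by auto
  qed auto
  then show "L S (level \<mu> A d f) x = level \<mu> (A - S) (d - card S) (L S f) x"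
    by (simp only: L_level_eq_sum[OF assms(1)] level_def[of \<mu> "A - S"])
qed

lemma L_level_zero:
  assumes "S \<subseteq> A" "card S > d"
  shows "L S (level \<mu> A d f) = (\<lambda>x. 0)"
proof -
  have "{U. U \<subseteq> A \<and> card U = d \<and> S \<subseteq> U} = {}"
  proof -
    have "\<not> (U \<subseteq> A \<and> card U = d \<and> S \<subseteq> U)" for U
      using card_mono[OF finite_sub, of U S] assms(2) by auto
    then show ?thesis by simp
  qed
  then show ?thesis by (simp only: L_level_eq_sum[OF assms(1)] sum.empty)
qed

text \<open>A part indexed by U survives \<open>L S\<close> exactly when S is a subset of U, so by
  orthogonality its energy is counted 2^d times.\<close>

lemma sum_E_sq_L_level:
  "(\<Sum>S\<in>Pow A. E A (\<lambda>x. (L S (level \<mu> A d f) x)\<^sup>2) z) = 2 ^ d * E A (\<lambda>x. (level \<mu> A d f x)\<^sup>2) z"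
proof -
  let ?\<U> = "{U. U \<subseteq> A \<and> card U = d}"
  define e where "e U = E A (\<lambda>x. (Q A U f x)\<^sup>2) z" for U
  have fin: "finite ?\<U>" using finA by simp
  have "(\<Sum>S\<in>Pow A. E A (\<lambda>x. (L S (level \<mu> A d f) x)\<^sup>2) z)
      = (\<Sum>S\<in>Pow A. \<Sum>U\<in>?\<U>. if S \<subseteq> U then e U else 0)"
  proof (intro sum.cong refl)
    fix S assume "S \<in> Pow A"
    then have "E A (\<lambda>x. (L S (level \<mu> A d f) x)\<^sup>2) z = (\<Sum>U\<in>{U. U \<subseteq> A \<and> card U = d \<and> S \<subseteq> U}. e U)"
      unfolding e_def by (subst L_level_eq_sum) (auto intro!: E_sq_sum_level_parts)
    also have "\<dots> = (\<Sum>U\<in>?\<U>. if S \<subseteq> U then e U else 0)"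
      using sum.inter_filter[OF fin, of e "\<lambda>U. S \<subseteq> U"] by (simp only: mem_Collect_eq conj_assoc)
    finally show "E A (\<lambda>x. (L S (level \<mu> A d f) x)\<^sup>2) z = (\<Sum>U\<in>?\<U>. if S \<subseteq> U then e U else 0)" .
  qed
  also have "\<dots> = (\<Sum>U\<in>?\<U>. \<Sum>S\<in>Pow A. if S \<subseteq> U then e U else 0)" by (rule sum.swap)
  also have "\<dots> = (\<Sum>U\<in>?\<U>. 2 ^ d * e U)"
  proof (intro sum.cong refl)
    fix U assume U: "U \<in> ?\<U>"
    have "(\<Sum>S\<in>Pow A. if S \<subseteq> U then e U else 0) = (\<Sum>S\<in>{S \<in> Pow A. S \<subseteq> U}. e U)"
      using finA by (intro sum.inter_filter[symmetric]) simp
    also have "{S \<in> Pow A. S \<subseteq> U} = Pow U" using U by auto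
    also have "(\<Sum>S\<in>Pow U. e U) = 2 ^ d * e U" using U finite_sub by (auto simp: card_Pow)
    finally show "(\<Sum>S\<in>Pow A. if S \<subseteq> U then e U else 0) = 2 ^ d * e U" .
  qed
  also have "\<dots> = 2 ^ d * E A (\<lambda>x. (level \<mu> A d f x)\<^sup>2) z"
    unfolding level_def e_def by (subst E_sq_sum_level_parts) (auto simp: sum_distrib_left)
  finally show ?thesis .
qed

end

section \<open>The level inequality\<close>

text \<open>Hoelder bounds W by the 2m-th moment of the level, and hypercontractivity bounds that
  moment by a power of W. The hypothesis \<open>deriv\<close> measures derivatives against W itself,
  so that W cancels down to a single m-th power.\<close>

lemma level_energy_step:
  fixes A :: "nat set" and d :: nat and f :: "(nat \<Rightarrow> 'a) \<Rightarrow> real" and z :: "nat \<Rightarrow> 'a"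
  defines "W \<equiv> E A (\<lambda>x. (level \<mu> A d f x)\<^sup>2) z"
  assumes fin: "finite A" and "\<gamma> > 0" "d \<ge> 1" "2 * real d \<le> \<l>"
    and f1: "E A (\<lambda>x. \<bar>f x\<bar>) z \<le> \<gamma>"
    and f2: "E A (\<lambda>x. (f x)\<^sup>2) z \<le> (\<gamma> * exp \<l>)\<^sup>2"
    and deriv: "\<And>S x. S \<subseteq> A \<Longrightarrow> S \<noteq> {} \<Longrightarrow> card S \<le> d \<Longrightarrow>
      E (A - S) (\<lambda>x. (L S (level \<mu> A d f) x)\<^sup>2) x \<le> (real d / \<l>) ^ card S * W"
  shows "W \<le> \<gamma>\<^sup>2 * (864 * (\<l> / real d)) ^ d"
proof (cases "W = 0")
  case True
  then show ?thesis using assms(4,5) by simp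
next
  case False
  define g where "g = level \<mu> A d f"
  have W: "W = E A (\<lambda>x. (g x)\<^sup>2) z" by (simp add: W_def g_def)
  have "W \<ge> 0" unfolding W using fin by (auto intro: E_nonneg)
  with False have "W > 0" by simp
  have "\<l> > 0" using assms(4,5) by linarith
  define t where "t = \<l> / real d"
  have "t \<ge> 2" using assms(4,5) by (simp add: t_def field_simps)
  \<comment> \<open>Rounding up gives \<open>t \<le> real m\<close>; since \<open>t \<ge> 2\<close>,
    rounding costs at most a factor 3/2.\<close>
  define m where "m = nat \<lceil>t\<rceil>"
  have m: "t \<le> real m" "real m \<le> 3 / 2 * t"
    using \<open>t \<ge> 2\<close> by (simp_all add: m_def) linarith+
  then have "m \<ge> 2" using \<open>t \<ge> 2\<close> by linarith
  define G where "G = E A (\<lambda>x. ((g x)\<^sup>2) ^ m) z"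
  have "G \<ge> 0" unfolding G_def using fin by (auto intro: E_nonneg)

  \<comment> \<open>Jensen with weight |f| moves the m-th power onto g and costs m - 1 copies of the
    L1 norm of f. Cauchy-Schwarz then separates the remaining |f| from |g|^m, bringing in the L2
    norm of f.\<close>
  have holder: "W ^ m * W ^ m \<le> \<gamma> ^ (2 * m) * exp (2 * \<l>) * G"
  proof -
    have "W = E A (\<lambda>x. f x * g x) z"
      unfolding W g_def using E_mult_level[OF fin] by simp
    also have "\<dots> \<le> E A (\<lambda>x. \<bar>f x\<bar> * \<bar>g x\<bar>) z"
      by (intro E_mono[OF fin]) (simp flip: abs_mult)
    finally have "W ^ m \<le> (E A (\<lambda>x. \<bar>f x\<bar> * \<bar>g x\<bar>) z) ^ m"
      using \<open>W \<ge> 0\<close> by (intro power_mono)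
    also have "\<dots> \<le> (E A (\<lambda>x. \<bar>f x\<bar>) z) ^ (m - 1) * E A (\<lambda>x. \<bar>f x\<bar> * \<bar>g x\<bar> ^ m) z"
      using \<open>m \<ge> 2\<close> by (intro power_mean_E fin) auto
    also have "\<dots> \<le> \<gamma> ^ (m - 1) * E A (\<lambda>x. \<bar>f x\<bar> * \<bar>g x\<bar> ^ m) z"
      using f1 fin by (intro mult_right_mono power_mono E_nonneg) auto
    finally have "(W ^ m)\<^sup>2 \<le> (\<gamma> ^ (m - 1) * E A (\<lambda>x. \<bar>f x\<bar> * \<bar>g x\<bar> ^ m) z)\<^sup>2"
      using \<open>W \<ge> 0\<close> by (intro power_mono) auto
    also have "\<dots> = (\<gamma> ^ (m - 1))\<^sup>2 * (E A (\<lambda>x. \<bar>f x\<bar> * \<bar>g x\<bar> ^ m) z)\<^sup>2"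
      by (rule power_mult_distrib)
    also have "\<dots> \<le> (\<gamma> ^ (m - 1))\<^sup>2 * (E A (\<lambda>x. \<bar>f x\<bar>\<^sup>2) z * E A (\<lambda>x. (\<bar>g x\<bar> ^ m)\<^sup>2) z)"
      by (intro mult_left_mono Cauchy_Schwarz_E[OF fin]) auto
    also have "E A (\<lambda>x. (\<bar>g x\<bar> ^ m)\<^sup>2) z = G"
    proof -
      have "(\<bar>a\<bar> ^ m)\<^sup>2 = (a\<^sup>2) ^ m" for a :: real
        by (metis power2_abs power_mult mult.commute)
      then show ?thesis by (simp add: G_def)
    qed
    also have "(\<gamma> ^ (m - 1))\<^sup>2 * (E A (\<lambda>x. \<bar>f x\<bar>\<^sup>2) z * G)
        \<le> (\<gamma> ^ (m - 1))\<^sup>2 * ((\<gamma> * exp \<l>)\<^sup>2 * G)"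
      using f2 \<open>G \<ge> 0\<close> by (intro mult_left_mono mult_right_mono) auto
    also have "\<dots> = (\<gamma> ^ (m - 1) * \<gamma>)\<^sup>2 * (exp \<l>)\<^sup>2 * G"
      by (simp add: power_mult_distrib)
    also have "\<gamma> ^ (m - 1) * \<gamma> = \<gamma> ^ m" using \<open>m \<ge> 2\<close> by (cases m) auto
    also have "(exp \<l>)\<^sup>2 = exp (2 * \<l>)" by (rule exp_double[symmetric])
    also have "(\<gamma> ^ m)\<^sup>2 = \<gamma> ^ (2 * m)" by (simp add: mult.commute flip: power_mult)
    finally show ?thesis by (simp only: power2_eq_square[of "W ^ m"])
  qed

  define \<rho> where "\<rho> = sqrt (1 / (32 * real m))"
  have \<rho>: "\<rho> \<ge> 0" "\<rho>\<^sup>2 = 1 / (32 * real m)" by (simp_all add: \<rho>_def)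
  define \<Lambda> where "\<Lambda> = (real m / 8) ^ m"
  have "\<Lambda> \<ge> 0" by (simp add: \<Lambda>_def)
  \<comment> \<open>The weight of one derivative coordinate is beaten by m - 1 powers of the gain
    d/\<l> = 1/t: m/(8t) \<le> 3/16 is relaxed to 1/2, and the leftover factor m/8 is at most 2^m/8,
    so the product is at most 1/4.\<close>
  have small: "\<Lambda> * (real d / \<l>) ^ (m - 1) \<le> 1"
  proof -
    obtain k where k: "m = Suc k" using \<open>m \<ge> 2\<close> by (cases m) auto
    have dl: "real d / \<l> = 1 / t" by (simp add: t_def)
    have "real m / 8 * (1 / t) \<le> 1 / 2" using m \<open>t \<ge> 2\<close> by (simp add: field_simps)
    then have "(real m / 8 * (1 / t)) ^ k \<le> (1 / 2) ^ k"
      using \<open>t \<ge> 2\<close> by (intro power_mono) auto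
    moreover have "real m \<le> 2 ^ m" using less_exp[of m] by (metis less_imp_le of_nat_le_iff of_nat_numeral of_nat_power)
    ultimately have "real m / 8 * (real m / 8 * (1 / t)) ^ k \<le> 2 ^ m / 8 * (1 / 2) ^ k"
      using \<open>t \<ge> 2\<close> by (intro mult_mono) auto
    also have "\<dots> = 1 / 4" by (simp add: k power_divide)
    finally show ?thesis
      unfolding \<Lambda>_def dl power_mult_distrib by (simp add: k mult_ac)
  qed
  have term_bound: "\<Lambda> ^ card S * E S (\<lambda>y. (E (A - S) (\<lambda>x. (L S g x)\<^sup>2) y) ^ m) z
      \<le> W ^ (m - 1) * E A (\<lambda>x. (L S g x)\<^sup>2) z" if "S \<subseteq> A" for S
  proof -
    have fS: "finite S" "finite (A - S)" using that fin finite_subset by auto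
    define X where "X = E (A - S) (\<lambda>x. (L S g x)\<^sup>2)"
    have X0: "X y \<ge> 0" for y unfolding X_def using fS by (auto intro: E_nonneg)
    have EX: "E S X z = E A (\<lambda>x. (L S g x)\<^sup>2) z"
      unfolding X_def using E_set_union[of S "A - S" \<mu>] fS that by (simp add: Un_absorb1)
    have Xm: "X y ^ m = X y ^ (m - 1) * X y" for y using \<open>m \<ge> 2\<close> by (cases m) auto
    consider "S = {}" | "card S > d" | "S \<noteq> {}" "card S \<le> d" by linarith
    then show ?thesis
    proof cases
      case 1
      then have "X z = W" by (simp add: X_def W L_set_empty)
      then show ?thesis using 1 Xm[of z] by (simp add: E_set_empty L_set_empty X_def)
    next
      case 2
      then have "L S g = (\<lambda>x. 0)" unfolding g_def by (intro L_level_zero fin that)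
      then show ?thesis using fS fin \<open>m \<ge> 2\<close> by (simp add: power_0_left)
    next
      case 3
      define q where "q = (real d / \<l>) ^ card S"
      have "E S (\<lambda>y. X y ^ m) z \<le> E S (\<lambda>y. (q * W) ^ (m - 1) * X y) z"
      proof (rule E_mono[OF fS(1)])
        fix y
        have "X y \<le> q * W" unfolding X_def q_def g_def using 3 that by (intro deriv)
        then show "X y ^ m \<le> (q * W) ^ (m - 1) * X y"
          unfolding Xm using X0 by (intro mult_right_mono power_mono)
      qed
      also have "\<dots> = q ^ (m - 1) * W ^ (m - 1) * E S X z"
        by (simp add: E_set_cmult[OF fS(1)] power_mult_distrib)
      finally have "\<Lambda> ^ card S * E S (\<lambda>y. X y ^ m) z
          \<le> \<Lambda> ^ card S * (q ^ (m - 1) * W ^ (m - 1) * E S X z)"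
        using \<open>\<Lambda> \<ge> 0\<close> by (intro mult_left_mono) auto
      also have "\<dots> = (\<Lambda> * (real d / \<l>) ^ (m - 1)) ^ card S * (W ^ (m - 1) * E S X z)"
        by (simp add: q_def power_mult_distrib mult.commute flip: power_mult)
      also have "\<dots> \<le> 1 * (W ^ (m - 1) * E S X z)"
        using small \<open>\<Lambda> \<ge> 0\<close> \<open>\<l> > 0\<close> \<open>W \<ge> 0\<close> X0 fS
        by (intro mult_right_mono power_le_one mult_nonneg_nonneg E_nonneg) auto
      finally show ?thesis by (simp add: EX) (simp add: X_def)
    qed
  qed
  \<comment> \<open>On level d the noise operator is multiplication by \<rho>^d, so with no
    coordinate treated yet the left side of \<open>hypercontractive\<close> is a multiple of
    G.\<close>
  have "((\<rho>\<^sup>2) ^ d) ^ m * G = E A (\<lambda>y. (E {} (\<lambda>x. (T \<rho> A g x)\<^sup>2) y) ^ m) z"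
  proof -
    have "(E {} (\<lambda>x. (T \<rho> A g x)\<^sup>2) y) ^ m = ((\<rho>\<^sup>2) ^ d) ^ m * ((g y)\<^sup>2) ^ m" for y
      unfolding g_def T_level[OF fin]
      by (simp add: E_set_empty power_mult_distrib mult.commute flip: power_mult)
    then show ?thesis by (simp add: E_set_cmult[OF fin] G_def)
  qed
  also have "\<dots> \<le> (\<Sum>S\<in>Pow A. \<Lambda> ^ card S * E S (\<lambda>y. (E (A - S) (\<lambda>x. (L S g x)\<^sup>2) y) ^ m) z)"
    unfolding \<Lambda>_def
    using hypercontractive[OF fin finite.emptyI _ \<open>m \<ge> 2\<close> \<rho>, of g z] by simp
  also have "\<dots> \<le> (\<Sum>S\<in>Pow A. W ^ (m - 1) * E A (\<lambda>x. (L S g x)\<^sup>2) z)"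
    by (intro sum_mono term_bound) auto
  also have "\<dots> = W ^ (m - 1) * (2 ^ d * W)"
    unfolding W unfolding g_def sum_distrib_left[symmetric] sum_E_sq_L_level[OF fin] ..
  also have "\<dots> = 2 ^ d * W ^ m" using \<open>m \<ge> 2\<close> by (cases m) auto
  finally have "((\<rho>\<^sup>2) ^ d) ^ m * G \<le> 2 ^ d * W ^ m" .
  then have "((32 * real m) ^ d) ^ m * (((\<rho>\<^sup>2) ^ d) ^ m * G) \<le> ((32 * real m) ^ d) ^ m * (2 ^ d * W ^ m)"
    by (intro mult_left_mono) auto
  moreover have "((32 * real m) ^ d) ^ m * ((\<rho>\<^sup>2) ^ d) ^ m = 1"
  proof -
    have "32 * real m * \<rho>\<^sup>2 = 1" using \<open>m \<ge> 2\<close> \<rho>(2) by simp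
    then have "((32 * real m * \<rho>\<^sup>2) ^ d) ^ m = 1" by simp
    then show ?thesis by (simp only: power_mult_distrib)
  qed
  ultimately have G: "G \<le> ((32 * real m) ^ d) ^ m * (2 ^ d * W ^ m)"
    by (simp only: mult.assoc[symmetric] mult_1)

  \<comment> \<open>Because m is at least \<l>/d, the ratio between the L1 and L2 bounds costs only
    9^d once the m-th root is taken.\<close>
  have exp2: "exp (2 * \<l>) \<le> (9 ^ d) ^ m"
  proof -
    have "\<l> = t * real d" using assms(4) by (simp add: t_def)
    also have "\<dots> \<le> real m * real d" using m by (intro mult_right_mono) auto
    finally have "exp (2 * \<l>) \<le> exp (real (2 * d * m) * 1)" by (simp add: mult_ac)
    also have "\<dots> = exp 1 ^ (2 * d * m)" by (rule exp_of_nat_mult)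
    also have "\<dots> \<le> 3 ^ (2 * d * m)" using exp_le by (intro power_mono) auto
    also have "\<dots> = (9 ^ d) ^ m" by (simp add: power_mult)
    finally show ?thesis .
  qed
  have "W ^ m * W ^ m \<le> \<gamma> ^ (2 * m) * exp (2 * \<l>) * G" by (rule holder)
  also have "\<dots> \<le> \<gamma> ^ (2 * m) * (9 ^ d) ^ m * (((32 * real m) ^ d) ^ m * ((2 ^ d) ^ m * W ^ m))"
  proof -
    \<comment> \<open>A deliberate loss that makes every constant an m-th power; then W^m cancels
      and the m-th root can be taken.\<close>
    have "(2 :: real) ^ d \<le> (2 ^ d) ^ m"
      using \<open>m \<ge> 2\<close> power_increasing[of 1 m "2 ^ d :: real"] by simp
    then have "((32 * real m) ^ d) ^ m * (2 ^ d * W ^ m) \<le> ((32 * real m) ^ d) ^ m * ((2 ^ d) ^ m * W ^ m)"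
      using \<open>W \<ge> 0\<close> by (intro mult_left_mono mult_right_mono) auto
    with G have "G \<le> ((32 * real m) ^ d) ^ m * ((2 ^ d) ^ m * W ^ m)" by linarith
    then show ?thesis
      using exp2 \<open>\<gamma> > 0\<close> \<open>G \<ge> 0\<close> by (intro mult_mono) auto
  qed
  also have "\<dots> = (\<gamma>\<^sup>2 * (9 * (32 * real m * 2)) ^ d) ^ m * W ^ m"
    by (simp only: power_mult power_mult_distrib mult.assoc)
  finally have "W ^ m \<le> (\<gamma>\<^sup>2 * (9 * (32 * real m * 2)) ^ d) ^ m"
    using \<open>W > 0\<close> by simp
  then have "W \<le> \<gamma>\<^sup>2 * (9 * (32 * real m * 2)) ^ d"
    using power_mono_iff[of W "\<gamma>\<^sup>2 * (9 * (32 * real m * 2)) ^ d" m] \<open>W \<ge> 0\<close> \<open>m \<ge> 2\<close> by simp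
  \<comment> \<open>Here 9 * 32 * 2 = 576, and m \<le> 3t/2 turns it into 864.\<close>
  also have "\<dots> \<le> \<gamma>\<^sup>2 * (864 * t) ^ d"
    using m by (intro mult_left_mono power_mono) auto
  finally show ?thesis by (simp add: t_def)
qed

section \<open>Induction on the degree\<close>

definition L1_L2_global where
  "L1_L2_global A r \<gamma> \<l> d f \<longleftrightarrow> (\<forall>S x. S \<subseteq> A \<longrightarrow> card S \<le> d \<longrightarrow>
     E (A - S) (\<lambda>x. \<bar>L S f x\<bar>) x \<le> r ^ card S * \<gamma> \<and>
     E (A - S) (\<lambda>x. (L S f x)\<^sup>2) x \<le> (r ^ card S * (\<gamma> * exp \<l>))\<^sup>2)"

text \<open>Derivatives compose along disjoint sets. Both bounds grow by the same factor r^|S|, so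
  their ratio exp \<l> is unchanged and the induction can keep \<l> fixed.\<close>

lemma L1_L2_global_derivative:
  assumes "L1_L2_global A r \<gamma> \<l> d f" "finite A" "S \<subseteq> A" "card S \<le> d"
  shows "L1_L2_global (A - S) r (r ^ card S * \<gamma>) \<l> (d - card S) (L S f)"
  unfolding L1_L2_global_def
proof (intro allI impI)
  fix R x assume R: "R \<subseteq> A - S" "card R \<le> d - card S"
  have "finite (A - S)" "finite S" using assms(2,3) finite_subset by auto
  with R have fin: "finite R" "finite S" "R \<inter> S = {}" using finite_subset by auto
  then have "card (R \<union> S) = card R + card S" by (rule card_Un_disjoint)
  moreover have "L R (L S f) = L (R \<union> S) f" using fin by (simp add: L_set_union)
  moreover have "A - S - R = A - (R \<union> S)" by auto
  moreover have "R \<union> S \<subseteq> A" "card (R \<union> S) \<le> d" using R assms(3,4) calculation(1) by auto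
  ultimately show "E (A - S - R) (\<lambda>x. \<bar>L R (L S f) x\<bar>) x \<le> r ^ card R * (r ^ card S * \<gamma>) \<and>
      E (A - S - R) (\<lambda>x. (L R (L S f) x)\<^sup>2) x \<le> (r ^ card R * (r ^ card S * \<gamma> * exp \<l>))\<^sup>2"
    using assms(1)[unfolded L1_L2_global_def, rule_format, of "R \<union> S" x]
    by (simp add: power_add mult.assoc)
qed

text \<open>The square of the target constant \<gamma>'_d. For d = 0 the quotient \<l>/0 is 0 and
  0^0 = 1, so the value is \<gamma>^2.\<close>

definition energy_bound :: "real \<Rightarrow> real \<Rightarrow> real \<Rightarrow> nat \<Rightarrow> real" where
  "energy_bound r \<gamma> \<l> d = (33 * r) ^ (2 * d) * \<gamma>\<^sup>2 * (\<l> / real d) ^ d"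

text \<open>With e = d - s, the powers of r match exactly. Replacing (\<l>/e)^e by (\<l>/d)^e costs
  (1 + s/e)^e \<le> exp s, well below the factor 33^(2s) by which the constants differ.\<close>

lemma energy_bound_derivative:
  assumes "r \<ge> 1" "\<l> > 0" "s \<le> d"
  shows "energy_bound r (r ^ s * \<gamma>) \<l> (d - s) \<le> (real d / \<l>) ^ s * energy_bound r \<gamma> \<l> d"
proof -
  define e where "e = d - s"
  have d: "d = e + s" using assms(3) by (simp add: e_def)
  have main: "(\<l> / real e) ^ e \<le> 33 ^ (2 * s) * (\<l> / real d) ^ e"
  proof (cases "e = 0")
    case False
    then have "e > 0" by simp
    have "1 + real s / real e = real d / real e" using \<open>e > 0\<close> by (simp add: d field_simps)
    then have "\<l> / real e = \<l> / real d * (1 + real s / real e)"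
      using \<open>e > 0\<close> d by simp
    then have "(\<l> / real e) ^ e = (1 + real s / real e) ^ e * (\<l> / real d) ^ e"
      by (metis power_mult_distrib mult.commute)
    also have "\<dots> \<le> 33 ^ (2 * s) * (\<l> / real d) ^ e"
    proof (intro mult_right_mono)
      have "(1 + real s / real e) ^ e \<le> exp (real s / real e) ^ e"
        by (intro power_mono exp_ge_add_one_self) auto
      also have "\<dots> = exp (real s * 1)"
        using \<open>e > 0\<close> by (simp flip: exp_of_nat_mult)
      also have "\<dots> = exp 1 ^ s" by (rule exp_of_nat_mult)
      also have "\<dots> \<le> (33\<^sup>2) ^ s" using exp_le by (intro power_mono) auto
      finally show "(1 + real s / real e) ^ e \<le> 33 ^ (2 * s)" by (simp add: power_mult)
    qed (use assms(2) in auto)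
    finally show ?thesis .
  qed simp
  have "energy_bound r (r ^ s * \<gamma>) \<l> e = 33 ^ (2 * e) * r ^ (2 * d) * \<gamma>\<^sup>2 * (\<l> / real e) ^ e"
    by (simp add: energy_bound_def d power_mult_distrib power_add power_mult[symmetric] mult.commute)
  also have "\<dots> \<le> 33 ^ (2 * e) * r ^ (2 * d) * \<gamma>\<^sup>2 * (33 ^ (2 * s) * (\<l> / real d) ^ e)"
    using main assms(1) by (intro mult_left_mono) auto
  also have "\<dots> = (33 * r) ^ (2 * d) * \<gamma>\<^sup>2 * (\<l> / real d) ^ e"
    by (simp add: d power_mult_distrib power_add distrib_left)
  also have "\<dots> = (real d / \<l>) ^ s * energy_bound r \<gamma> \<l> d"
  proof (cases "d = 0")
    case False
    then have "(real d / \<l>) ^ s * (\<l> / real d) ^ s = 1"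
      using assms(2) by (simp flip: power_mult_distrib)
    moreover have "(\<l> / real d) ^ d = (\<l> / real d) ^ e * (\<l> / real d) ^ s"
      by (simp add: d power_add)
    ultimately show ?thesis by (simp add: energy_bound_def)
  qed (simp add: energy_bound_def d)
  finally show ?thesis by (simp add: e_def)
qed

text \<open>In degree 0 the level is the mean of f, bounded by the L1 norm. In positive degree,
  assume the bound fails: by induction the derivatives obey bounds stated through
  \<open>energy_bound\<close>, which W now exceeds, so W may replace it and
  \<open>level_energy_step\<close> applies.\<close>

lemma level_energy_bound:
  assumes "finite A" "r \<ge> 1" "\<gamma> > 0" "\<l> > 0" "2 * real d \<le> \<l>" "L1_L2_global A r \<gamma> \<l> d f"
  shows "E A (\<lambda>x. (level \<mu> A d f x)\<^sup>2) z \<le> energy_bound r \<gamma> \<l> d"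
  using assms
proof (induction d arbitrary: A f \<gamma> z rule: less_induct)
  case (less d)
  note fin = less.prems(1)
  have f1: "E A (\<lambda>x. \<bar>f x\<bar>) z \<le> \<gamma>" and f2: "E A (\<lambda>x. (f x)\<^sup>2) z \<le> (\<gamma> * exp \<l>)\<^sup>2"
    using less.prems(6)[unfolded L1_L2_global_def, rule_format, of "{}" z] by (simp_all add: L_set_empty)
  show ?case
  proof (cases "d = 0")
    case True
    have "{U. U \<subseteq> A \<and> card U = 0} = {{}}" using finite_subset[OF _ fin] by auto
    then have level: "level \<mu> A d f = E A f"
      by (simp add: level_def True level_part_def L_set_empty)
    have ind: "E A f (x(i := a)) = E A f x" if "i \<in> A" for x i a
      using that fin by (intro E_upd)
    have "E A (\<lambda>x. (E A f x)\<^sup>2) z = (E A f z)\<^sup>2"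
    proof -
      \<comment> \<open>The factor 1 gives the square the shape of a product in which both copies of
        the mean, constant along \<open>A\<close>, can be pulled out.\<close>
      have "E A (\<lambda>x. E A f x * (E A f x * 1)) = (\<lambda>x. E A f x * (E A f x * 1))"
        using fin ind by (simp only: E_mult_indep E_const)
      then show ?thesis by (simp add: power2_eq_square)
    qed
    also have "\<dots> \<le> \<gamma>\<^sup>2"
    proof -
      have "E A f z \<le> E A (\<lambda>x. \<bar>f x\<bar>) z" "E A (\<lambda>x. (- 1) * f x) z \<le> E A (\<lambda>x. \<bar>f x\<bar>) z"
        by (auto intro: E_mono[OF fin])
      then have "\<bar>E A f z\<bar> \<le> \<gamma>" using f1 unfolding E_set_cmult[OF fin] by linarith
      then show ?thesis by (metis abs_ge_zero power2_abs power_mono)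
    qed
    finally show ?thesis by (simp only: level) (simp add: energy_bound_def True)
  next
    case False
    define W where "W = E A (\<lambda>x. (level \<mu> A d f x)\<^sup>2) z"
    show ?thesis
    proof (rule ccontr)
      assume "\<not> ?thesis"
      then have big: "energy_bound r \<gamma> \<l> d < W" by (simp add: W_def)
      have "E (A - S) (\<lambda>x. (L S (level \<mu> A d f) x)\<^sup>2) x \<le> (real d / \<l>) ^ card S * W"
        if S: "S \<subseteq> A" "S \<noteq> {}" "card S \<le> d" for S x
      proof -
        have "card S > 0" using S fin finite_subset by (auto simp: card_gt_0_iff)
        have "E (A - S) (\<lambda>x. (level \<mu> (A - S) (d - card S) (L S f) x)\<^sup>2) x
            \<le> energy_bound r (r ^ card S * \<gamma>) \<l> (d - card S)"
          using S less.prems False \<open>card S > 0\<close>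
          by (intro less.IH L1_L2_global_derivative) (auto simp: of_nat_diff)
        also have "\<dots> \<le> (real d / \<l>) ^ card S * energy_bound r \<gamma> \<l> d"
          using less.prems S by (intro energy_bound_derivative) auto
        also have "\<dots> \<le> (real d / \<l>) ^ card S * W"
          using big less.prems(4) by (intro mult_left_mono) auto
        finally show ?thesis using S fin by (simp add: L_level)
      qed
      then have "W \<le> \<gamma>\<^sup>2 * (864 * (\<l> / real d)) ^ d"
        unfolding W_def using False less.prems f1 f2 by (intro level_energy_step) auto
      \<comment> \<open>The constant 33 comes from here: 33^2 = 1089 \<ge> 864.\<close>
      also have "\<dots> \<le> \<gamma>\<^sup>2 * ((33 * r)\<^sup>2 * (\<l> / real d)) ^ d"
      proof -
        have "33 * 33 \<le> (33 * r) * (33 * r)" using less.prems(2) by (intro mult_mono) auto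
        then show ?thesis using less.prems(4)
          by (intro mult_left_mono power_mono mult_right_mono) (auto simp: power2_eq_square)
      qed
      also have "\<dots> = energy_bound r \<gamma> \<l> d"
        unfolding energy_bound_def power_mult power_mult_distrib[of "(33 * r)\<^sup>2"]
        by (simp only: mult_ac)
      finally show False using big by simp
    qed
  qed
qed

lemma level_derivative_energy_bound:
  assumes "finite A" "r \<ge> 1" "\<gamma> > 0" "\<l> > 0" "2 * real d \<le> \<l>" "L1_L2_global A r \<gamma> \<l> d f" "S \<subseteq> A"
  shows "E (A - S) (\<lambda>x. (L S (level \<mu> A d f) x)\<^sup>2) z \<le> (real d / \<l>) ^ card S * energy_bound r \<gamma> \<l> d"
proof (cases "card S \<le> d")
  case True
  have "E (A - S) (\<lambda>x. (level \<mu> (A - S) (d - card S) (L S f) x)\<^sup>2) z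
      \<le> energy_bound r (r ^ card S * \<gamma>) \<l> (d - card S)"
    using assms True by (intro level_energy_bound L1_L2_global_derivative) (auto simp: of_nat_diff)
  also have "\<dots> \<le> (real d / \<l>) ^ card S * energy_bound r \<gamma> \<l> d"
    using assms True by (intro energy_bound_derivative) auto
  finally show ?thesis using assms True by (simp add: L_level)
next
  case False
  then show ?thesis using assms by (simp add: L_level_zero energy_bound_def)
qed

section \<open>From norms of derivatives to partial averages\<close>

lemma Lp_norm_deriv_D:
  assumes "finite A" "S \<subseteq> A" "z \<in> PiE A (\<lambda>_. UNIV)" "\<And>i. i \<in> S \<Longrightarrow> x i = z i"
  shows "Lp_norm \<mu> (A - S) p (deriv_D \<mu> S x g) = E (A - S) (\<lambda>y. \<bar>L S g y\<bar> powr p) z powr (1 / p)"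
proof -
  \<comment> \<open>Outside \<open>A\<close> both glued points are \<open>undefined\<close>, since
    \<open>y\<close> and \<open>z\<close> are extensional; this is why \<open>z\<close> is taken in
    \<open>PiE A\<close>.\<close>
  have "(\<lambda>i. if i \<in> S then x i else y i) = (\<lambda>i. if i \<in> A - S then y i else z i)"
    if "y \<in> PiE (A - S) (\<lambda>_. UNIV)" for y
    using that assms(2-4) by (auto simp: PiE_def extensional_def fun_eq_iff)
  then show ?thesis
    unfolding Lp_norm_def deriv_D_def E_set_eq_sum[OF finite_Diff[OF assms(1)]] by simp
qed

lemma L1_norm_deriv_D:
  assumes "finite A" "S \<subseteq> A" "z \<in> PiE A (\<lambda>_. UNIV)" "\<And>i. i \<in> S \<Longrightarrow> x i = z i"
  shows "Lp_norm \<mu> (A - S) 1 (deriv_D \<mu> S x g) = E (A - S) (\<lambda>y. \<bar>L S g y\<bar>) z"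
  using assms by (simp add: Lp_norm_deriv_D[of A S z x] E_nonneg)

lemma L2_norm_deriv_D:
  assumes "finite A" "S \<subseteq> A" "z \<in> PiE A (\<lambda>_. UNIV)" "\<And>i. i \<in> S \<Longrightarrow> x i = z i"
  shows "Lp_norm \<mu> (A - S) 2 (deriv_D \<mu> S x g) = sqrt (E (A - S) (\<lambda>y. (L S g y)\<^sup>2) z)"
  using assms by (simp add: Lp_norm_deriv_D[of A S z x] E_nonneg powr_half_sqrt)

text \<open>Changing a coordinate inside \<open>A\<close> commutes with restriction to
  \<open>A\<close>. This and the next lemmas allow \<open>f\<close> to be replaced by a function
  determined by extensional points, so that bounds known only there hold at every argument.\<close>

lemma EC_restrict:
  assumes "i \<in> A"
  shows "EC i (\<lambda>x. F (restrict x A)) = (\<lambda>x. EC i F (restrict x A))"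
proof -
  have "restrict (x(i := a)) A = (restrict x A)(i := a)" for x :: "nat \<Rightarrow> 'a" and a
    using assms by auto
  then show ?thesis by (simp add: E_coord_def del: fun_upd_apply)
qed

lemma E_restrict:
  assumes "finite S" "S \<subseteq> A"
  shows "E S (\<lambda>x. F (restrict x A)) = (\<lambda>x. E S F (restrict x A))"
  using assms by (induction S) (simp_all add: E_set_empty E_set_insert EC_restrict)

lemma L_restrict:
  assumes "finite S" "S \<subseteq> A"
  shows "L S (\<lambda>x. F (restrict x A)) = (\<lambda>x. L S F (restrict x A))"
  using assms by (induction S) (simp_all add: L_set_empty L_set_insert L_coord_def EC_restrict)

lemma level_restrict:
  assumes "finite A"
  shows "level \<mu> A d (\<lambda>x. F (restrict x A)) = (\<lambda>x. level \<mu> A d F (restrict x A))"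
proof -
  have "Q A U (\<lambda>x. F (restrict x A)) = (\<lambda>x. Q A U F (restrict x A))" if "U \<subseteq> A" for U
    using that assms finite_subset[OF that] by (simp add: level_part_def E_restrict L_restrict)
  then show ?thesis by (simp add: level_def)
qed

end

theorem mainTheorem7:
  fixes \<mu> :: "'a::finite \<Rightarrow> real" and n d :: nat and r \<gamma>1 \<gamma>2 :: real
    and f :: "(nat \<Rightarrow> 'a) \<Rightarrow> real"
  assumes "prob_weights \<mu>"
    and "r \<ge> 1" and "\<gamma>1 > 0" and "\<gamma>2 > \<gamma>1"
    and "real d \<le> ln (\<gamma>2 / \<gamma>1) / 2"
    and "global_Lp_d \<mu> n 1 r \<gamma>1 d f"
    and "global_Lp_d \<mu> n 2 r \<gamma>2 d f"
  shows "global_L2 \<mu> n (sqrt (real d) / sqrt (ln (\<gamma>2 / \<gamma>1)))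
           ((33 * r / sqrt (real d)) ^ d * \<gamma>1 * ln (\<gamma>2 / \<gamma>1) powr (real d / 2))
           (level_d \<mu> n d f)"
proof -
  interpret prob_space_weights \<mu> by unfold_locales (rule assms(1))
  define A where "A = {..<n}"
  have fin: "finite A" by (simp add: A_def)
  define l where "l = ln (\<gamma>2 / \<gamma>1)"
  have "l > 0" using assms(3,4) by (simp add: l_def)
  have \<gamma>2: "\<gamma>2 = \<gamma>1 * exp l" using assms(3,4) by (simp add: l_def)
  \<comment> \<open>\<open>f\<close> is controlled only at extensional points, hence the detour through a restriction.\<close>
  define h where "h = (\<lambda>x. f (restrict x A))"
  have global: "L1_L2_global A r \<gamma>1 l d h"
    unfolding L1_L2_global_def
  proof (intro allI impI conjI)
    fix S and x :: "nat \<Rightarrow> 'a" assume S: "S \<subseteq> A" "card S \<le> d"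
    define z where "z = restrict x A"
    have z: "z \<in> PiE A (\<lambda>_. UNIV)" by (simp add: z_def)
    have zS: "restrict z S \<in> PiE S (\<lambda>_. UNIV)" by simp
    have fS: "finite S" using S(1) fin by (rule finite_subset)
    have L: "L S h = (\<lambda>x. L S f (restrict x A))"
      unfolding h_def using fS S(1) by (rule L_restrict)
    have "Lp_norm \<mu> (A - S) 1 (deriv_D \<mu> S (restrict z S) f) \<le> r ^ card S * \<gamma>1"
      using assms(6) S zS by (auto simp: global_Lp_d_def A_def)
    moreover have "Lp_norm \<mu> (A - S) 1 (deriv_D \<mu> S (restrict z S) f)
        = E_set \<mu> (A - S) (\<lambda>y. \<bar>L S f y\<bar>) z"
      using fin S(1) z by (rule L1_norm_deriv_D) simp
    ultimately show "E_set \<mu> (A - S) (\<lambda>x. \<bar>L S h x\<bar>) x \<le> r ^ card S * \<gamma>1"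
      using E_restrict[of "A - S" A "\<lambda>x. \<bar>L S f x\<bar>"] fin by (simp add: L z_def)
    have "Lp_norm \<mu> (A - S) 2 (deriv_D \<mu> S (restrict z S) f) \<le> r ^ card S * \<gamma>2"
      using assms(7) S zS by (auto simp: global_Lp_d_def A_def)
    moreover have "Lp_norm \<mu> (A - S) 2 (deriv_D \<mu> S (restrict z S) f)
        = sqrt (E_set \<mu> (A - S) (\<lambda>y. (L S f y)\<^sup>2) z)"
      using fin S(1) z by (rule L2_norm_deriv_D) simp
    ultimately have "E_set \<mu> (A - S) (\<lambda>y. (L S f y)\<^sup>2) z \<le> (r ^ card S * \<gamma>2)\<^sup>2"
      by (simp add: sqrt_le_D)
    then show "E_set \<mu> (A - S) (\<lambda>x. (L S h x)\<^sup>2) x \<le> (r ^ card S * (\<gamma>1 * exp l))\<^sup>2"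
      using E_restrict[of "A - S" A "\<lambda>x. (L S f x)\<^sup>2"] fin by (simp add: L z_def \<gamma>2)
  qed
  define B where "B = (33 * r / sqrt (real d)) ^ d * \<gamma>1 * l powr (real d / 2)"
  have "B \<ge> 0" using assms(2,3) by (simp add: B_def)
  \<comment> \<open>This holds for d = 0 as well: the base 33r/0 is 0, its 0-th power is 1, and both
    sides reduce to \<gamma>1^2.\<close>
  have B2: "B\<^sup>2 = energy_bound r \<gamma>1 l d"
  proof -
    have "(l powr (real d / 2))\<^sup>2 = l ^ d"
      using \<open>l > 0\<close> by (simp add: powr_power powr_realpow)
    moreover have "((33 * r / sqrt (real d)) ^ d)\<^sup>2 = (33 * r) ^ (2 * d) / real d ^ d"
    proof -
      have "((33 * r / sqrt (real d)) ^ d)\<^sup>2 = ((33 * r / sqrt (real d))\<^sup>2) ^ d"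
        by (simp only: mult.commute flip: power_mult)
      also have "\<dots> = ((33 * r)\<^sup>2 / real d) ^ d" by (simp add: power_divide)
      finally show ?thesis by (simp only: power_divide power_mult)
    qed
    moreover have "(a * b * c)\<^sup>2 = a\<^sup>2 * b\<^sup>2 * c\<^sup>2" for a b c :: real
      by (simp add: power_mult_distrib)
    ultimately have "B\<^sup>2 = (33 * r) ^ (2 * d) / real d ^ d * \<gamma>1\<^sup>2 * l ^ d" by (simp only: B_def)
    then show ?thesis by (simp add: energy_bound_def power_divide)
  qed
  have "Lp_norm \<mu> (A - S) 2 (deriv_D \<mu> S x (level \<mu> A d f))
      \<le> (sqrt (real d) / sqrt l) ^ card S * B"
    if S: "S \<subseteq> A" and x: "x \<in> PiE S (\<lambda>_. UNIV)" for S x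
  proof -
    define z where "z = restrict x A"
    have z: "z \<in> PiE A (\<lambda>_. UNIV)" by (simp add: z_def)
    have fS: "finite S" using S fin by (rule finite_subset)
    have "x i = z i" if "i \<in> S" for i using that S by (auto simp: z_def)
    with fin S z have "Lp_norm \<mu> (A - S) 2 (deriv_D \<mu> S x (level \<mu> A d f))
        = sqrt (E_set \<mu> (A - S) (\<lambda>y. (L S (level \<mu> A d f) y)\<^sup>2) z)"
      by (rule L2_norm_deriv_D)
    \<comment> \<open>All operators involved act within \<open>A\<close>, so passing from
      \<open>f\<close> to \<open>h\<close> only restricts the argument \<open>z\<close>, which is
      already restricted.\<close>
    also have "E_set \<mu> (A - S) (\<lambda>y. (L S (level \<mu> A d f) y)\<^sup>2) z
        = E_set \<mu> (A - S) (\<lambda>y. (L S (level \<mu> A d h) y)\<^sup>2) z"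
      using E_restrict[of "A - S" A "\<lambda>y. (L S (level \<mu> A d f) y)\<^sup>2"] fin S fS
      by (simp add: h_def level_restrict L_restrict z_def)
    also have "sqrt \<dots> \<le> (sqrt (real d) / sqrt l) ^ card S * B"
    proof (rule real_le_lsqrt)
      have "E_set \<mu> (A - S) (\<lambda>y. (L S (level \<mu> A d h) y)\<^sup>2) z
          \<le> (real d / l) ^ card S * energy_bound r \<gamma>1 l d"
        using fin assms(2,3,5) \<open>l > 0\<close> global S
        by (intro level_derivative_energy_bound) (auto simp: l_def)
      also have "(real d / l) ^ card S = ((sqrt (real d) / sqrt l) ^ card S)\<^sup>2"
      proof -
        have "real d / l = (sqrt (real d) / sqrt l)\<^sup>2" using \<open>l > 0\<close> by (simp add: power_divide)
        then show ?thesis by (simp only: mult.commute flip: power_mult)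
      qed
      finally show "E_set \<mu> (A - S) (\<lambda>y. (L S (level \<mu> A d h) y)\<^sup>2) z
          \<le> ((sqrt (real d) / sqrt l) ^ card S * B)\<^sup>2"
        by (simp add: B2 power_mult_distrib)
    qed (use \<open>B \<ge> 0\<close> \<open>l > 0\<close> in simp)
    finally show ?thesis .
  qed
  then show ?thesis
    unfolding global_L2_def level_d_eq_level B_def l_def A_def by auto
qed

end
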